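(* Let $P(x)\in\mathbb{Z}[x]$ be irreducible over $\mathbb{Q}$ of degree $d\geq 2$. Let $r\geq 1$ and let $A_1,\dots,A_r$ be fixed positive integers. For each $i\in\{1,\dots,r\}$ let $H^{(i)}$ be one of the following sequences, indexed by positive integers $n$ (the choice may differ from one $i$ to another): $A_i^{n}[1,\dots,n]$, $A_i^{n}n!$, $A_i^{n}n!!$, $A_i^{p_n}\,p_n\#$, $A_i^{n}\,p_n\#$, or $A_i^{n}\,n\#$. Then the Diophantine equation $$P(x)=\prod_{i=1}^r H^{(i)}_{n_i}$$ has only finitely many solutions $(x,n_1,\dots,n_r)$ with $x\in\mathbb{Z}$ and $n_1,\dots,n_r$ positive integers.
   Context: $[1,\dots,n]$ denotes the least common multiple of $1,2,\dots,n$. $n!!$ denotes the double factorial $n(n-2)(n-4)\cdots$ (ending in $1$ or $2$). $n\#$ denotes the primorial, the product of all primes $\leq n$. $p_n$ denotes the $n$-th prime, and $p_n\#$ is the product of the first $n$ primes. *)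

theory Defs
  imports "HOL-Computational_Algebra.Computational_Algebra"
begin

text \<open>The n-th prime p_n, 1-indexed: p_1 = 2, p_2 = 3, ...\<close>
definition nth_prime :: "nat \<Rightarrow> nat" where
  "nth_prime n = (LEAST p. prime p \<and> card {q. prime q \<and> q \<le> p} = n)"

fun dfact :: "nat \<Rightarrow> nat" where
  "dfact 0 = 1"
| "dfact (Suc 0) = 1"
| "dfact (Suc (Suc n)) = Suc (Suc n) * dfact n"

definition primorial :: "nat \<Rightarrow> nat" where
  "primorial n = \<Prod>{p. prime p \<and> p \<le> n}"

definition lcm_upto :: "nat \<Rightarrow> nat" where
  "lcm_upto n = Lcm {1..n}"

datatype seq_kind = LcmK | FactK | DFactK | PrimPK | PrimNK | PrimorialK

fun H :: "seq_kind \<Rightarrow> nat \<Rightarrow> nat \<Rightarrow> nat" where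
  "H LcmK A n = A ^ n * lcm_upto n"
| "H FactK A n = A ^ n * fact n"
| "H DFactK A n = A ^ n * dfact n"
| "H PrimPK A n = A ^ nth_prime n * primorial (nth_prime n)"
| "H PrimNK A n = A ^ n * primorial (nth_prime n)"
| "H PrimorialK A n = A ^ n * primorial n"

end

theory Submission
  imports Defs "Jordan_Normal_Form.Char_Poly" "HOL-Number_Theory.Cong"
    "HOL-Computational_Algebra.Field_as_Ring"
begin

text \<open>
  It suffices to find a prime \<open>p > 2\<close> modulo which \<open>P\<close> has no root: \<open>p\<close> divides every term
  \<open>H\<^sub>n\<close> with \<open>n \<ge> 2p\<close>, so all \<open>n\<^sub>i\<close> are bounded. That such a prime exists is classically a
  consequence of Frobenius' density theorem and Jordan's theorem on fixed-point-free permutations;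
  here it is derived from two elementary counting arguments with norms \<open>N(a)\<close> in \<open>\<int>[x]/(P)\<close>,
  where \<open>P\<close> may be taken monic of degree \<open>d\<close>.

  (1) Suppose \<open>P\<close> has a root modulo every large prime, and let \<open>T\<close> be the set of primes modulo
  which it has two. For squarefree \<open>n \<in> (Y/2, Y]\<close> and a prime \<open>p \<in> T\<close> dividing \<open>n\<close>, choose one root
  modulo every prime factor of \<open>n\<close>, exchanging the root at \<open>p\<close> for the second one, and let \<open>r\<close> be
  the resulting root modulo \<open>n\<close>. The pigeonhole principle gives \<open>a \<noteq> 0\<close> with coefficients at most
  \<open>Y\<^bsup>1/d\<^esup>\<close> and \<open>a(r) \<equiv> 0\<close> modulo \<open>n\<close>, hence \<open>N(a) = n m\<close> with \<open>m\<close> bounded. As two common roots of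
  \<open>a\<close> and \<open>P\<close> modulo \<open>p\<close> force \<open>p\<^sup>2\<close> to divide \<open>N(a)\<close>, boundedly many pairs \<open>(n, p)\<close> share the same
  \<open>a\<close>, so there are \<open>O(Y)\<close> pairs. Counting them directly yields \<open>\<Sum>\<^sub>p\<^sub>\<in>\<^sub>T 1/p < \<infinity>\<close>.

  (2) For irreducible \<open>Q\<close> of degree \<open>D\<close>, the sum of \<open>1/p\<close> over the primes \<open>p\<close> modulo which \<open>Q\<close> has
  a root diverges. Otherwise, take \<open>a = 1 + M b\<close> with \<open>M = P\<^sub>0!\<close> and \<open>b\<close> in a box of side \<open>Z\<close>. Then \<open>N(a)\<close>
  has no prime factor up to \<open>P\<^sub>0\<close>, and it is rarely \<open>\<plusminus>1\<close>. A prime \<open>p\<close> dividing \<open>N(a)\<close> places \<open>b\<close> in one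
  of at most \<open>D\<close> lattice cosets, one for each irreducible factor of \<open>Q\<close> modulo \<open>p\<close>. For a factor of
  degree \<open>f\<close>, nonzero lattice vectors have norm divisible by \<open>p\<^bsup>f\<^esup>\<close>, so the coset has \<open>O(Z\<^bsup>D\<^esup>/p\<^bsup>f\<^esup>)\<close>
  points in the box, and \<open>f = 1\<close> requires a root modulo \<open>p\<close>. Altogether too few \<open>b\<close> are covered.

  Applied to the minimal polynomial \<open>Q\<close> of a primitive element of \<open>\<rat>(\<alpha>, \<beta>)\<close>, for two roots
  \<open>\<alpha> \<noteq> \<beta>\<close> of \<open>P\<close>, (2) contradicts (1): modulo a large prime a root of \<open>Q\<close> yields two roots of \<open>P\<close>.
\<close>

hide_const (open) Module.smult

section \<open>Norms modulo a monic polynomial\<close>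

text \<open>For monic \<open>P\<close> pseudo-division is ordinary division with remainder, and it
  is available over \<int>.\<close>

definition monic_rem :: "int poly \<Rightarrow> int poly \<Rightarrow> int poly" where
  "monic_rem P a = snd (pseudo_divmod a P)"

text \<open>Multiplication by \<open>a\<close> on \<int>[x]/(P) in the basis of powers of x. The
  images of the basis vectors are the rows, so the matrix acts on row vectors.\<close>

definition mult_mat :: "int poly \<Rightarrow> int poly \<Rightarrow> int mat" where
  "mult_mat P a = mat (degree P) (degree P) (\<lambda>(i, j). coeff (monic_rem P (monom 1 i * a)) j)"

text \<open>For monic \<open>P\<close> this is the norm from \<int>[x]/(P) to \<int>, the product of
  the values of \<open>a\<close> at the complex roots of \<open>P\<close>.\<close>

definition pnorm :: "int poly \<Rightarrow> int poly \<Rightarrow> int" where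
  "pnorm P a = det (mult_mat P a)"

lemma monic_rem:
  assumes "lead_coeff P = 1"
  obtains q where "a = P * q + monic_rem P a"
    and "monic_rem P a = 0 \<or> degree (monic_rem P a) < degree P"
proof -
  obtain q r where qr: "pseudo_divmod a P = (q, r)" by fastforce
  have "P \<noteq> 0" using assms by auto
  from pseudo_divmod[OF this qr] assms have "a = P * q + r" "r = 0 \<or> degree r < degree P"
    by auto
  with qr show ?thesis using that unfolding monic_rem_def by auto
qed

lemma monic_rem_unique:
  assumes P: "lead_coeff P = 1" and a: "a = P * q + r" and r: "r = 0 \<or> degree r < degree P"
  shows "monic_rem P a = r"
proof -
  obtain q' where q': "a = P * q' + monic_rem P a"
    and r': "monic_rem P a = 0 \<or> degree (monic_rem P a) < degree P"
    using monic_rem[OF P] by blast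
  have P0: "P \<noteq> 0" using P by auto
  have eq: "P * (q - q') = monic_rem P a - r"
    using a q' by (simp add: algebra_simps)
  have "q - q' = 0"
  proof (rule ccontr)
    assume nz: "q - q' \<noteq> 0"
    then have "monic_rem P a - r \<noteq> 0" using eq P0 by (metis mult_eq_0_iff)
    moreover have "degree (P * (q - q')) \<ge> degree P"
      using nz P0 by (simp add: degree_mult_eq)
    moreover have "monic_rem P a - r \<noteq> 0 \<Longrightarrow> degree (monic_rem P a - r) < degree P"
      using r r' degree_diff_less[of "monic_rem P a" "degree P" r] by auto
    ultimately show False using eq by auto
  qed
  then show ?thesis using eq by auto
qed

lemma poly_as_sum_lessThan:
  assumes "degree (r :: int poly) < n"
  shows "(\<Sum>i<n. smult (coeff r i) (monom 1 i)) = r"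
  by (rule poly_eqI) (use assms in \<open>auto simp: coeff_sum if_distrib[of "\<lambda>x. _ * x"] coeff_eq_0 cong: if_cong\<close>)

lemma det_cong_mod:
  fixes A B :: "int mat"
  assumes A: "A \<in> carrier_mat n n" and B: "B \<in> carrier_mat n n"
    and AB: "\<And>i j. i < n \<Longrightarrow> j < n \<Longrightarrow> [A $$ (i, j) = B $$ (i, j)] (mod m)"
  shows "[det A = det B] (mod m)"
  unfolding det_def'[OF A] det_def'[OF B]
  by (intro cong_sum cong_mult cong_prod cong_refl AB) auto

locale monic_poly =
  fixes P :: "int poly"
  assumes monic: "lead_coeff P = 1" and deg_pos: "degree P > 0"
begin

abbreviation rm where "rm \<equiv> monic_rem P"
abbreviation d where "d \<equiv> degree P"

lemma degree_rm: "degree (rm a) < d"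
  using monic_rem[OF monic, of a] deg_pos by (metis degree_0)

lemma rm_cong: assumes "P dvd a - b" shows "rm a = rm b"
proof -
  obtain q where q: "a - b = P * q" using assms by (auto simp: dvd_def)
  obtain q' where q': "b = P * q' + rm b" using monic_rem[OF monic] by blast
  have "a = P * (q + q') + rm b" using q q' by (simp add: algebra_simps)
  then show ?thesis using monic_rem_unique[OF monic] degree_rm by blast
qed

lemma rm_small: "degree a < d \<Longrightarrow> rm a = a"
  by (rule monic_rem_unique[OF monic, of _ 0]) auto

lemma dvd_diff_rm: "P dvd a - rm a"
  using monic_rem[OF monic, of a] by (metis add_diff_cancel_right' dvd_triv_left)

lemma rm_add: "rm (a + b) = rm a + rm b"
proof -
  have "P dvd (a + b) - (rm a + rm b)"
    using dvd_add[OF dvd_diff_rm[of a] dvd_diff_rm[of b]] by (simp add: algebra_simps)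
  then show ?thesis
    by (metis rm_cong rm_small degree_add_less degree_rm)
qed

lemma rm_smult: "rm (smult c a) = smult c (rm a)"
proof -
  have "P dvd smult c a - smult c (rm a)"
    using dvd_smult[OF dvd_diff_rm[of a]] by (simp add: smult_diff_right)
  moreover have "degree (smult c (rm a)) < d"
    using degree_rm[of a] degree_smult_le[of c "rm a"] by linarith
  ultimately show ?thesis
    by (metis rm_cong rm_small)
qed

lemma rm_uminus: "rm (- a) = - rm a"
  using rm_smult[of "-1" a] by simp

lemma rm_0 [simp]: "rm 0 = 0"
  using rm_small deg_pos by simp

lemma rm_sum: "rm (\<Sum>i\<in>A. f i) = (\<Sum>i\<in>A. rm (f i))"
  by (induction A rule: infinite_finite_induct) (auto simp: rm_add)

lemma rm_mult_rm: "rm (rm a * b) = rm (a * b)"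
proof (rule rm_cong)
  have "rm a * b - a * b = - ((a - rm a) * b)" by (simp add: algebra_simps)
  then show "P dvd rm a * b - a * b" using dvd_diff_rm[of a] by (metis dvd_minus_iff dvd_mult2)
qed

lemma mult_mat_carrier [simp]: "mult_mat P a \<in> carrier_mat d d"
  by (simp add: mult_mat_def)

lemma mult_mat_index: "i < d \<Longrightarrow> j < d \<Longrightarrow> mult_mat P a $$ (i, j) = coeff (rm (monom 1 i * a)) j"
  by (simp add: mult_mat_def)

text \<open>Row \<open>i\<close> of the first factor lists the coefficients of the reduced x^i a;
  the second factor replaces each x^k in it by the reduced x^k b. The row convention keeps the order
  of the factors.\<close>

lemma mult_mat_mult: "mult_mat P (a * b) = mult_mat P a * mult_mat P b"
proof (rule eq_matI)
  fix i j assume "i < dim_row (mult_mat P a * mult_mat P b)" "j < dim_col (mult_mat P a * mult_mat P b)"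
  then have ij: "i < d" "j < d" by (auto simp: mult_mat_def)
  let ?r = "rm (monom 1 i * a)"
  have "(mult_mat P a * mult_mat P b) $$ (i, j) =
      (\<Sum>k<d. coeff ?r k * coeff (rm (monom 1 k * b)) j)"
    using ij by (simp add: scalar_prod_def mult_mat_def atLeast0LessThan)
  also have "\<dots> = coeff (rm ((\<Sum>k<d. smult (coeff ?r k) (monom 1 k)) * b)) j"
    by (simp add: sum_distrib_right rm_sum rm_smult coeff_sum)
  also have "\<dots> = coeff (rm (monom 1 i * (a * b))) j"
    by (simp add: poly_as_sum_lessThan[OF degree_rm] rm_mult_rm mult.assoc)
  finally show "mult_mat P (a * b) $$ (i, j) = (mult_mat P a * mult_mat P b) $$ (i, j)"
    using ij by (simp add: mult_mat_index)
qed (auto simp: mult_mat_def)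

lemma pnorm_mult: "pnorm P (a * b) = pnorm P a * pnorm P b"
  unfolding pnorm_def mult_mat_mult by (rule det_mult[of _ d]) auto

lemma mult_mat_const: "mult_mat P [:c:] = c \<cdot>\<^sub>m 1\<^sub>m d"
proof (rule eq_matI)
  fix i j assume "i < dim_row (c \<cdot>\<^sub>m 1\<^sub>m d)" "j < dim_col (c \<cdot>\<^sub>m 1\<^sub>m d)"
  then have ij: "i < d" "j < d" by auto
  have "rm (monom 1 i * [:c:]) = monom c i"
    using ij rm_small[of "monom c i"] degree_monom_le[of c i]
    by (simp add: smult_monom)
  then show "mult_mat P [:c:] $$ (i, j) = (c \<cdot>\<^sub>m 1\<^sub>m d) $$ (i, j)"
    using ij by (simp add: mult_mat_index)
qed (auto simp: mult_mat_def)

lemma mult_mat_add: "mult_mat P (a + b) = mult_mat P a + mult_mat P b"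
  by (rule eq_matI) (auto simp: mult_mat_def ring_distribs rm_add)

lemma pnorm_1: "pnorm P 1 = 1"
  using mult_mat_const[of 1] by (simp add: pnorm_def one_pCons)

text \<open>Its use: norms of elements 1 + M b are 1 modulo M, hence coprime to M.\<close>

lemma pnorm_add_smult: "[pnorm P (a + smult m b) = pnorm P a] (mod m)"
  unfolding pnorm_def
  by (rule det_cong_mod[of _ d]) (auto simp: mult_mat_def cong_iff_dvd_diff ring_distribs rm_add rm_smult)

lemma pnorm_cong: "P dvd a - b \<Longrightarrow> pnorm P a = pnorm P b"
proof -
  assume "P dvd a - b"
  then have "rm (monom 1 i * a) = rm (monom 1 i * b)" for i
    by (intro rm_cong) (metis dvd_mult right_diff_distrib)
  then show ?thesis by (simp add: pnorm_def mult_mat_def)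
qed

text \<open>The hypothesis makes \<open>a\<close> invertible modulo \<open>P\<close> and
  \<open>m\<close>; multiplicativity of the norm transfers this to \<int>/m.\<close>

lemma pnorm_coprime:
  assumes "a * s + P * t + smult m w = 1"
  shows "[pnorm P a * pnorm P s = 1] (mod m)"
proof -
  have "a * s - (1 + smult m (-w)) = P * (- t)"
    unfolding assms[symmetric] by simp
  then have "P dvd a * s - (1 + smult m (-w))" by simp
  then have "pnorm P (a * s) = pnorm P (1 + smult m (-w))" by (rule pnorm_cong)
  then show ?thesis
    using pnorm_add_smult[of 1 m "-w"] by (simp add: pnorm_mult pnorm_1)
qed

text \<open>The multiples of \<open>a\<close>, reduced modulo \<open>P\<close>, lie in the ideal (g,
  m) of \<int>[x]/(P). With f = degree g this ideal has the basis m, m x, ..., m x^(f-1), g, x g,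
  ..., x^(d-f-1) g, of determinant m^f.\<close>

lemma pnorm_dvd:
  assumes g: "lead_coeff g = 1" "degree g \<le> d"
    and a: "a = g * e + smult m w" and P: "P = g * h + smult m k"
  shows "m ^ degree g dvd pnorm P a"
proof -
  define f where "f = degree g"
  define r where "r i = rm (monom 1 i * a)" for i
  have "\<exists>E W. r i = g * E + smult m W" for i
  proof -
    obtain q where "monom 1 i * a = P * q + r i"
      using monic_rem[OF monic] unfolding r_def by blast
    then have "r i = monom 1 i * (g * e + smult m w) - (g * h + smult m k) * q"
      using a P by simp
    then have "r i = g * (monom 1 i * e - h * q) + smult m (monom 1 i * w - k * q)"
      by (simp add: algebra_simps smult_diff_right)
    then show ?thesis by blast
  qed
  then obtain E W where EW: "\<And>i. r i = g * E i + smult m (W i)" by metis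
  \<comment> \<open>Reduced modulo the monic \<open>g\<close>, the part divisible by
    \<open>m\<close> involves only x^j with j < f; the quotient moves into the multiple of
    \<open>g\<close>.\<close>
  have "\<exists>q. W i = g * q + monic_rem g (W i)" for i
    using monic_rem[OF g(1), of "W i"] by blast
  then obtain q where q: "\<And>i. W i = g * q i + monic_rem g (W i)" by metis
  define s where "s i = monic_rem g (W i)" for i
  define u where "u i = E i + smult m (q i)" for i
  have ru: "r i = g * u i + smult m (s i)" for i
  proof -
    have "r i = g * E i + smult m (g * q i + s i)"
      using EW[of i] q[of i] unfolding s_def by (rule subst[of _ _ "\<lambda>x. _ = _ + smult m x", rotated])
    then show ?thesis by (simp add: u_def ring_distribs smult_add_right add.assoc)
  qed
  have g0: "g \<noteq> 0" using g by auto
  have sdeg: "s i = 0 \<or> degree (s i) < f" for i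
    unfolding s_def f_def using monic_rem[OF g(1)] by blast
  have sco: "coeff (s i) j = 0" if "j \<ge> f" for i j
    using sdeg[of i] that by (auto intro: coeff_eq_0)
  have udeg: "coeff (u i) j = 0" if "j \<ge> d - f" for i j
  proof (cases "u i = 0")
    case False
    have "coeff (g * u i) n = 0" if "n \<ge> d" for n
    proof -
      have "coeff (r i) n = 0" using degree_rm[of "monom 1 i * a"] that
        unfolding r_def by (intro coeff_eq_0) auto
      then show ?thesis using ru[of i] sco[of n i] that g(2) unfolding f_def by auto
    qed
    then have "degree (g * u i) < d"
      using g0 False by (meson leI leading_coeff_0_iff no_zero_divisors)
    then have "degree (u i) < d - f" using g0 False unfolding f_def
      by (simp add: degree_mult_eq)
    then show ?thesis using that by (intro coeff_eq_0) auto
  qed auto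
  \<comment> \<open>The rows of \<open>T\<close> are 1, x, ..., x^(f-1), g, x g, ...; the rows of
    \<open>B\<close> are the coordinates of the \<open>r i\<close> with respect to them.
    \<open>T\<close> is lower triangular with unit diagonal because \<open>g\<close> is
    monic.\<close>
  define B where "B = mat d d (\<lambda>(i, j). if j < f then m * coeff (s i) j else coeff (u i) (j - f))"
  define T where "T = mat d d (\<lambda>(j, k). if j < f then (if j = k then 1 else 0) else coeff (monom 1 (j - f) * g) k)"
  have BT: "mult_mat P a = B * T"
  proof (rule eq_matI)
    fix i k assume "i < dim_row (B * T)" "k < dim_col (B * T)"
    then have ik: "i < d" "k < d" by (auto simp: B_def T_def)
    have "(B * T) $$ (i, k) = (\<Sum>j<d. B $$ (i, j) * T $$ (j, k))"
      using ik by (simp add: scalar_prod_def B_def T_def atLeast0LessThan)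
    also have "{..<d} = {..<f} \<union> {f..<d}" using g(2) unfolding f_def by auto
    also have "(\<Sum>j\<in>{..<f} \<union> {f..<d}. B $$ (i, j) * T $$ (j, k)) =
        (\<Sum>j<f. B $$ (i, j) * T $$ (j, k)) + (\<Sum>j=f..<d. B $$ (i, j) * T $$ (j, k))"
      by (rule sum.union_disjoint) auto
    also have "(\<Sum>j<f. B $$ (i, j) * T $$ (j, k)) = (\<Sum>j<f. if j = k then m * coeff (s i) j else 0)"
      by (rule sum.cong) (use ik g(2) in \<open>auto simp: B_def T_def f_def\<close>)
    also have "\<dots> = coeff (smult m (s i)) k"
      using sco[of k i] by auto
    also have "(\<Sum>j=f..<d. B $$ (i, j) * T $$ (j, k)) =
        (\<Sum>j=f..<d. coeff (u i) (j - f) * coeff (monom 1 (j - f) * g) k)"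
      by (rule sum.cong) (use ik in \<open>auto simp: B_def T_def\<close>)
    also have "\<dots> = (\<Sum>j<d - f. coeff (u i) j * coeff (monom 1 j * g) k)"
      by (rule sum.reindex_bij_witness[of _ "\<lambda>j. j + f" "\<lambda>j. j - f"]) auto
    also have "\<dots> = coeff ((\<Sum>j<d - f. smult (coeff (u i) j) (monom 1 j)) * g) k"
      by (simp add: sum_distrib_right coeff_sum)
    also have "(\<Sum>j<d - f. smult (coeff (u i) j) (monom 1 j)) = u i"
      by (rule poly_eqI)
        (use udeg in \<open>auto simp: coeff_sum if_distrib[of "\<lambda>x. _ * x"] not_less cong: if_cong\<close>)
    finally show "mult_mat P a $$ (i, k) = (B * T) $$ (i, k)"
      using ik ru[of i] by (simp add: mult_mat_index r_def mult.commute)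
  qed (auto simp: mult_mat_def B_def T_def)
  have "det T = prod_list (diag_mat T)"
  proof (rule det_lower_triangular)
    fix i j assume ij: "i < j" "j < d"
    have "coeff (monom 1 (i - f) * g) j = 0" if "\<not> i < f"
      using ij that degree_mult_le[of "monom 1 (i - f)" g] degree_monom_le[of "1::int" "i - f"]
      by (intro coeff_eq_0) (auto simp: f_def)
    then show "T $$ (i, j) = 0" using ij by (auto simp: T_def)
  qed (simp add: T_def)
  also have "diag_mat T = map (\<lambda>_. 1) [0..<d]"
    using g(1) by (auto simp: diag_mat_def T_def coeff_monom_mult f_def)
  also have "prod_list \<dots> = (1 :: int)" by (simp add: map_replicate_const)
  finally have T1: "det T = 1" .
  have "pnorm P a = det B"
    unfolding pnorm_def BT using det_mult[of B d T] T1 by (auto simp: B_def T_def)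
  also have "m ^ f dvd det B"
  proof -
    have Bc: "B \<in> carrier_mat d d" by (simp add: B_def)
    \<comment> \<open>Each Leibniz product takes one entry from each of the first f columns of
      \<open>B\<close>, all divisible by \<open>m\<close>.\<close>
    have "m ^ f dvd (\<Prod>i = 0..<d. B $$ (i, p i))" if p: "p permutes {0..<d}" for p
    proof -
      define ip where "ip = inv_into UNIV p"
      have inv: "ip permutes {0..<d}" using permutes_inv[OF p] unfolding ip_def .
      have fd: "{0..<f} \<subseteq> {0..<d}" using g(2) f_def by auto
      have "(\<Prod>i = 0..<d. B $$ (i, p i)) = (\<Prod>j = 0..<d. B $$ (ip j, j))"
        by (rule prod.reindex_bij_witness[of _ "ip" p])
          (use p inv in \<open>auto simp: permutes_inverses[OF p, folded ip_def]\<close>)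
      also have "\<dots> = (\<Prod>j = 0..<f. B $$ (ip j, j)) * (\<Prod>j \<in> {0..<d} - {0..<f}. B $$ (ip j, j))"
        using prod.subset_diff[OF fd] by (simp add: mult.commute)
      also have "m ^ f dvd (\<Prod>j = 0..<f. B $$ (ip j, j)) * (\<Prod>j \<in> {0..<d} - {0..<f}. B $$ (ip j, j))"
      proof (rule dvd_mult2)
        have "(\<Prod>j = 0..<f. m) dvd (\<Prod>j = 0..<f. B $$ (ip j, j))"
          by (rule prod_dvd_prod) (use fd inv in \<open>auto simp: B_def\<close>)
        then show "m ^ f dvd (\<Prod>j = 0..<f. B $$ (ip j, j))" by simp
      qed
      finally show ?thesis .
    qed
    then show ?thesis unfolding det_def'[OF Bc] by (intro dvd_sum) auto
  qed
  finally show ?thesis unfolding f_def .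
qed

text \<open>The matrix entries are linear in the coefficients of \<open>a\<close>, so the
  determinant is homogeneous of degree \<open>d\<close>.\<close>

lemma pnorm_bound:
  obtains C :: int where "C > 0"
    "\<And>a k. degree a < d \<Longrightarrow> (\<And>i. \<bar>coeff a i\<bar> \<le> k) \<Longrightarrow> \<bar>pnorm P a\<bar> \<le> C * k ^ d"
proof -
  \<comment> \<open>The entries combine the reductions of x^(i+l) with i, l < d, so exponents below
    2 d suffice.\<close>
  define c where "c = 1 + (\<Sum>i<2*d. \<Sum>j<d. \<bar>coeff (rm (monom 1 i)) j\<bar>)"
  have c_pos: "c > 0" unfolding c_def by (simp add: sum_nonneg add_pos_nonneg)
  have c: "\<bar>coeff (rm (monom 1 i)) j\<bar> \<le> c" if "i < 2 * d" "j < d" for i j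
  proof -
    have "\<bar>coeff (rm (monom 1 i)) j\<bar> \<le> (\<Sum>j<d. \<bar>coeff (rm (monom 1 i)) j\<bar>)"
      using that by (intro member_le_sum) auto
    also have "\<dots> \<le> (\<Sum>i<2*d. \<Sum>j<d. \<bar>coeff (rm (monom 1 i)) j\<bar>)"
      using that by (intro member_le_sum[where f = "\<lambda>i. \<Sum>j<d. \<bar>coeff (rm (monom 1 i)) j\<bar>"]) (auto intro: sum_nonneg)
    finally show ?thesis by (simp add: c_def)
  qed
  show ?thesis
  proof
    show "fact d * (int d * c) ^ d > 0" using c_pos deg_pos by simp
    fix a :: "int poly" and k :: int assume a: "degree a < d" and k: "\<And>i. \<bar>coeff a i\<bar> \<le> k"
    have k0: "k \<ge> 0" using k[of 0] by (rule order.trans[OF abs_ge_zero])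
    have e: "\<bar>mult_mat P a $$ (i, j)\<bar> \<le> int d * c * k" if ij: "i < d" "j < d" for i j
    proof -
      have "rm (monom 1 i * a) = rm (monom 1 i * (\<Sum>l<d. smult (coeff a l) (monom 1 l)))"
        using poly_as_sum_lessThan[OF a] by simp
      also have "\<dots> = (\<Sum>l<d. smult (coeff a l) (rm (monom 1 (i + l))))"
        by (simp add: sum_distrib_left rm_sum rm_smult mult_monom)
      finally have "mult_mat P a $$ (i, j) = (\<Sum>l<d. coeff a l * coeff (rm (monom 1 (i + l))) j)"
        using ij by (simp add: mult_mat_index coeff_sum)
      also have "\<bar>\<dots>\<bar> \<le> (\<Sum>l<d. k * c)"
        by (rule order.trans[OF sum_abs], rule sum_mono)
          (use ij k k0 c in \<open>auto simp: abs_mult intro!: mult_mono\<close>)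
      finally show ?thesis by (simp add: algebra_simps)
    qed
    have mc: "mult_mat P a \<in> carrier_mat d d" by simp
    have "\<bar>pnorm P a\<bar> \<le> (\<Sum>p | p permutes {0..<d}. \<bar>signof p * (\<Prod>i = 0..<d. mult_mat P a $$ (i, p i))\<bar>)"
      unfolding pnorm_def det_def'[OF mc] by (rule sum_abs)
    also have "\<dots> \<le> (\<Sum>p | p permutes {0..<d}. (int d * c * k) ^ d)"
    proof (rule sum_mono)
      fix p assume "p \<in> {p. p permutes {0..<d}}"
      then have p: "p permutes {0..<d}" by simp
      have "\<bar>signof p * (\<Prod>i = 0..<d. mult_mat P a $$ (i, p i))\<bar> = (\<Prod>i = 0..<d. \<bar>mult_mat P a $$ (i, p i)\<bar>)"
        by (simp add: abs_mult abs_prod sign_def)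
      also have "\<dots> \<le> (\<Prod>i = 0..<d. int d * c * k)"
        by (rule prod_mono) (use e p in auto)
      finally show "\<bar>signof p * (\<Prod>i = 0..<d. mult_mat P a $$ (i, p i))\<bar> \<le> (int d * c * k) ^ d" by simp
    qed
    also have "\<dots> = fact d * (int d * c) ^ d * k ^ d"
      by (simp add: card_permutations[OF refl] power_mult_distrib)
    finally show "\<bar>pnorm P a\<bar> \<le> fact d * (int d * c) ^ d * k ^ d" .
  qed
qed

text \<open>As a function of x the norm of a + x is the characteristic polynomial of multiplication
  by -a, which is monic of degree \<open>d\<close>.\<close>

lemma card_pnorm_const_shift_le:
  "finite {x. pnorm P (a + [:x:]) = v}" "card {x. pnorm P (a + [:x:]) = v} \<le> d"
proof -
  let ?A = "mult_mat P (- a)"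
  have A: "?A \<in> carrier_mat d d" by simp
  have ev: "poly (char_poly ?A) x = pnorm P (a + [:x:])" for x
    unfolding char_poly_def pnorm_def
    by (rule poly_det_cong[of _ d])
      (auto simp: char_poly_matrix_def mult_mat_add mult_mat_const, auto simp: mult_mat_def rm_uminus)
  have dg: "degree (char_poly ?A) = d" and l: "coeff (char_poly ?A) d = 1"
    using degree_monic_char_poly[OF A] by auto
  have set: "{x. pnorm P (a + [:x:]) = v} = {x. poly (char_poly ?A - [:v:]) x = 0}"
    by (simp add: ev)
  have dg': "degree (char_poly ?A - [:v:]) = d"
    using dg deg_pos degree_add_eq_left[of "[:- v:]" "char_poly ?A"] by (simp add: diff_conv_add_uminus del: add_uminus_conv_diff)
  then have nz: "char_poly ?A - [:v:] \<noteq> 0" using deg_pos by auto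
  show "finite {x. pnorm P (a + [:x:]) = v}"
    unfolding set using poly_roots_finite[OF nz] .
  show "card {x. pnorm P (a + [:x:]) = v} \<le> d"
    unfolding set using card_poly_roots_bound[OF nz] dg' by simp
qed

end

locale irreducible_monic_poly = monic_poly +
  assumes irred: "irreducible (map_poly (of_int :: int \<Rightarrow> rat) P)"
begin

text \<open>A vanishing determinant yields a nonzero \<open>b\<close> of degree below
  \<open>d\<close> with \<open>P\<close> dividing b a. Over \<rat> the polynomial \<open>P\<close>
  is prime, yet it exceeds both factors in degree.\<close>

lemma pnorm_nonzero:
  assumes "a \<noteq> 0" "degree a < d"
  shows "pnorm P a \<noteq> 0"
proof
  let ?r = "map_poly (of_int :: int \<Rightarrow> rat)"
  \<comment> \<open>Transposed because a dependence between the rows is what provides the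
    coefficients of \<open>b\<close>.\<close>
  let ?M = "transpose_mat (mult_mat P a)"
  have c: "?M \<in> carrier_mat d d" by simp
  assume "pnorm P a = 0"
  then have "det ?M = 0" unfolding pnorm_def using det_transpose[of "mult_mat P a" d] by simp
  then obtain v where v: "v \<in> carrier_vec d" "v \<noteq> 0\<^sub>v d" "?M *\<^sub>v v = 0\<^sub>v d"
    using det_0_iff_vec_prod_zero[OF c] by blast
  define b where "b = (\<Sum>i<d. smult (v $ i) (monom 1 i))"
  have cb: "coeff b i = (if i < d then v $ i else 0)" for i
    by (auto simp: b_def coeff_sum if_distrib[of "\<lambda>x. _ * x"] cong: if_cong)
  have b0: "b \<noteq> 0"
  proof
    assume "b = 0"
    then have "v $ i = 0" if "i < d" for i using cb[of i] that by auto
    then show False using v by (auto simp: vec_eq_iff)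
  qed
  have bd: "degree b < d" using cb[of "degree b"] b0 by (auto split: if_splits)
  have "rm (b * a) = 0"
  proof (rule poly_eqI)
    fix j
    show "coeff (rm (b * a)) j = coeff 0 j"
    proof (cases "j < d")
      case True
      have "coeff (rm (b * a)) j = (\<Sum>i<d. v $ i * coeff (rm (monom 1 i * a)) j)"
        by (simp add: b_def sum_distrib_right rm_sum rm_smult coeff_sum)
      also have "\<dots> = (?M *\<^sub>v v) $ j"
        using True v(1) by (auto simp: scalar_prod_def mult_mat_def atLeast0LessThan mult.commute intro!: sum.cong)
      finally show ?thesis using v True by simp
    next
      case False
      then show ?thesis using degree_rm[of "b * a"] by (simp add: coeff_eq_0)
    qed
  qed
  then have "P dvd b * a" using dvd_diff_rm[of "b * a"] by simp
  then obtain q where "b * a = P * q" by (auto simp: dvd_def)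
  then have "?r b * ?r a = ?r P * ?r q"
    by (metis of_int_poly_hom.hom_mult)
  then have "?r P dvd ?r b * ?r a" by simp
  then have "?r P dvd ?r b \<or> ?r P dvd ?r a"
    by (rule prime_elem_dvd_multD[OF field_poly_irreducible_imp_prime[OF irred]])
  moreover have "\<not> ?r P dvd ?r c" if "c \<noteq> 0" "degree c < d" for c
    using that dvd_imp_degree_le[of "?r P" "?r c"] by (auto simp: degree_map_poly)
  ultimately show False using assms b0 bd by blast
qed

end

section \<open>Factors modulo a prime\<close>

text \<open>This and \<open>comax_mod\<close> express divisibility and comaximality in (\<int>/m)[x]
  by identities in \<int>[x], to which the norm lemmas apply directly.\<close>

definition dvd_mod :: "int \<Rightarrow> int poly \<Rightarrow> int poly \<Rightarrow> bool" where
  "dvd_mod m g a \<longleftrightarrow> (\<exists>e w. a = g * e + [:m:] * w)"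

definition comax_mod :: "int \<Rightarrow> int poly \<Rightarrow> int poly \<Rightarrow> bool" where
  "comax_mod m a b \<longleftrightarrow> (\<exists>s t w. a * s + b * t + [:m:] * w = 1)"

text \<open>\<open>h\<close> is the gcd of \<open>a\<close> and \<open>g\<close> modulo
  \<open>p\<close>, found as a monic element of least degree in the ideal (a, g, p).\<close>

lemma euclid_mod:
  fixes p :: int and a g :: "int poly"
  assumes p: "prime p" and g: "lead_coeff g = 1"
  obtains h s t w where "lead_coeff h = 1" "h = a * s + g * t + [:p:] * w"
    "dvd_mod p h a" "dvd_mod p h g"
proof -
  define I where "I b \<longleftrightarrow> (\<exists>s t w. b = a * s + g * t + [:p:] * w)" for b
  have I_add: "I (b + c)" if bc: "I b" "I c" for b c
  proof -
    obtain s t w where 1: "b = a * s + g * t + [:p:] * w" using bc I_def by blast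
    obtain s' t' w' where 2: "c = a * s' + g * t' + [:p:] * w'" using bc I_def by blast
    have "b + c = a * (s + s') + g * (t + t') + [:p:] * (w + w')"
      unfolding 1 2 by (simp only: ring_distribs ac_simps)
    then show ?thesis unfolding I_def by blast
  qed
  have I_mult: "I (b * c)" if b: "I b" for b c
  proof -
    obtain s t w where 1: "b = a * s + g * t + [:p:] * w" using b I_def by blast
    have "b * c = a * (s * c) + g * (t * c) + [:p:] * (w * c)"
      unfolding 1 by (simp only: ring_distribs ac_simps)
    then show ?thesis unfolding I_def by blast
  qed
  have I_p: "I ([:p:] * w)" for w
    unfolding I_def by (rule exI[of _ 0], rule exI[of _ 0], rule exI[of _ w]) simp
  have I_a: "I a" unfolding I_def
    by (rule exI[of _ 1], rule exI[of _ 0], rule exI[of _ 0]) simp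
  have I_g: "I g" unfolding I_def
    by (rule exI[of _ 0], rule exI[of _ 1], rule exI[of _ 0]) simp
  define n where "n = (LEAST n. \<exists>h. I h \<and> lead_coeff h = 1 \<and> degree h = n)"
  have ex: "\<exists>n h. I h \<and> lead_coeff h = 1 \<and> degree h = n" using I_g g by blast
  obtain h where h: "I h" "lead_coeff h = 1" "degree h = n"
    using LeastI_ex[OF ex] unfolding n_def by blast
  have least: "n \<le> degree h'" if "I h'" "lead_coeff h' = 1" for h'
    unfolding n_def by (rule Least_le) (use that in blast)
  \<comment> \<open>The leading coefficient of such an \<open>r\<close> is divisible by
    \<open>p\<close>, since it could otherwise be turned into 1, against minimality. The leading
    term then lies in the ideal and is removed by induction.\<close>
  have small: "\<exists>w. r = [:p:] * w" if "I r" "r = 0 \<or> degree r < n" for r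
    using that
  proof (induction "degree r" arbitrary: r rule: less_induct)
    case less
    show ?case
    proof (cases "r = 0")
      case True
      then show ?thesis by (intro exI[of _ 0]) simp
    next
      case False
      define c where "c = lead_coeff r"
      have "p dvd c"
      proof (rule ccontr)
        assume "\<not> p dvd c"
        then have "coprime c p" using p by (metis coprime_commute prime_imp_coprime)
        then obtain x y where xy: "x * c + y * p = 1"
          by (metis bezout_int coprime_imp_gcd_eq_1)
        \<comment> \<open>The coefficient at \<open>degree r\<close> becomes x c + y p = 1.\<close>
        define h' where "h' = r * [:x:] + [:p:] * monom y (degree r)"
        have "I h'" unfolding h'_def by (intro I_add I_mult I_p less.prems)
        moreover have "degree h' \<le> degree r"
          unfolding h'_def
          by (intro degree_add_le) (auto simp: smult_monom degree_monom_le)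
        moreover have "coeff h' (degree r) = 1"
          using xy unfolding h'_def c_def by (simp add: mult.commute)
        ultimately have "degree h' = degree r" "lead_coeff h' = 1"
          by (metis le_antisym le_degree zero_neq_one)+
        then show False using least[OF \<open>I h'\<close>] less.prems False by auto
      qed
      then obtain c' where c': "c = p * c'" by (auto simp: dvd_def)
      define r' where "r' = r + [:p:] * monom (- c') (degree r)"
      have r'r: "r = r' + [:p:] * monom c' (degree r)"
        by (rule poly_eqI) (simp add: r'_def)
      have I': "I r'" unfolding r'_def by (intro I_add I_p less.prems)
      have "degree r' \<le> degree r"
        unfolding r'_def by (intro degree_add_le) (auto simp: smult_monom degree_monom_le)
      moreover have "coeff r' (degree r) = 0"
        unfolding r'_def using c' c_def by simp
      ultimately have "r' = 0 \<or> degree r' < degree r"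
        by (metis leading_coeff_0_iff le_neq_implies_less)
      then have "\<exists>w. r' = [:p:] * w"
      proof
        assume "r' = 0" then show ?thesis by (intro exI[of _ 0]) simp
      next
        assume "degree r' < degree r"
        then show ?thesis using less.hyps[of r'] I' less.prems by auto
      qed
      then obtain w where "r' = [:p:] * w" ..
      then have "r = [:p:] * (w + monom c' (degree r))"
        using r'r by (simp only: ring_distribs)
      then show ?thesis ..
    qed
  qed
  have dvd: "dvd_mod p h b" if "I b" for b
  proof -
    obtain q where q: "b = h * q + monic_rem h b"
      "monic_rem h b = 0 \<or> degree (monic_rem h b) < degree h"
      using monic_rem[OF h(2)] by blast
    have eq: "monic_rem h b = b + h * (- q)" using q(1) by (simp add: algebra_simps)
    have "I (monic_rem h b)" unfolding eq by (intro I_add I_mult that h)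
    then obtain w where "monic_rem h b = [:p:] * w" using small q(2) h(3) by blast
    then show ?thesis unfolding dvd_mod_def using q(1) by metis
  qed
  obtain s t w where stw: "h = a * s + g * t + [:p:] * w" using h(1) I_def by blast
  show ?thesis by (rule that[OF h(2) stw dvd[OF I_a] dvd[OF I_g]])
qed

text \<open>Dividing \<open>w\<close> by \<open>h\<close> as well shows that the remainder of
  \<open>b\<close> is \<open>m\<close> times that of \<open>w\<close>.\<close>

lemma dvd_mod_monic_rem:
  assumes h: "lead_coeff h = 1" and "dvd_mod m h b"
  obtains y where "monic_rem h b = [:m:] * y"
proof -
  obtain e w where b: "b = h * e + [:m:] * w" using assms by (auto simp: dvd_mod_def)
  obtain q where q: "w = h * q + monic_rem h w"
    "monic_rem h w = 0 \<or> degree (monic_rem h w) < degree h"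
    using monic_rem[OF h] by blast
  have "b = h * e + [:m:] * (h * q + monic_rem h w)" using b q(1) by simp
  also have "\<dots> = h * (e + [:m:] * q) + [:m:] * monic_rem h w"
    by (simp only: ring_distribs ac_simps)
  finally have "monic_rem h b = [:m:] * monic_rem h w"
    by (rule monic_rem_unique[OF h])
      (use q(2) degree_smult_le[of m "monic_rem h w"] in auto)
  then show ?thesis using that by blast
qed

lemma dvd_mod_refl: "dvd_mod m g g"
  unfolding dvd_mod_def by (rule exI[of _ 1], rule exI[of _ 0]) simp

lemma dvd_mod_trans:
  assumes "dvd_mod m g h" "dvd_mod m h b"
  shows "dvd_mod m g b"
proof -
  obtain e w where 1: "h = g * e + [:m:] * w" using assms by (auto simp: dvd_mod_def)
  obtain e' w' where 2: "b = h * e' + [:m:] * w'" using assms by (auto simp: dvd_mod_def)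
  have "b = g * (e * e') + [:m:] * (w * e' + w')"
    unfolding 2 1 by (simp only: ring_distribs ac_simps)
  then show ?thesis unfolding dvd_mod_def by blast
qed

text \<open>Multiply the two Bezout identities and replace the product h e by q - m y.\<close>

lemma comax_mod_mult:
  assumes "comax_mod m b h" "comax_mod m b e" and q: "q = h * e + [:m:] * y"
  shows "comax_mod m b q"
proof -
  obtain s t w where 1: "b * s + h * t + [:m:] * w = 1" using assms by (auto simp: comax_mod_def)
  obtain s' t' w' where 2: "b * s' + e * t' + [:m:] * w' = 1" using assms by (auto simp: comax_mod_def)
  define c where "c = [:m:]"
  have "b * (s * (b * s' + e * t' + c * w') + s' * (h * t + c * w)) + q * (t * t')
      + c * (h * t * w' + w * e * t' + c * w * w' - y * t * t') =
      (b * s + h * t + c * w) * (b * s' + e * t' + c * w')"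
    unfolding q c_def[symmetric] by (simp add: algebra_simps)
  also have "\<dots> = 1" using 1 2 unfolding c_def by simp
  finally show ?thesis unfolding comax_mod_def c_def by blast
qed

text \<open>The set consists of the irreducible factors of \<open>q\<close> modulo \<open>p\<close>.\<close>
lemma factors_mod:
  fixes p :: int and q :: "int poly"
  assumes p: "prime p" and q: "lead_coeff q = 1"
  shows "\<exists>G. finite G \<and> card G \<le> degree q \<and>
    (\<forall>g\<in>G. lead_coeff g = 1 \<and> degree g \<ge> 1 \<and> dvd_mod p g q) \<and>
    (\<forall>a. (\<exists>g\<in>G. dvd_mod p g a) \<or> comax_mod p a q)"
  using q
proof (induction "degree q" arbitrary: q rule: less_induct)
  case less
  \<comment> \<open>Either the gcd of \<open>q\<close> with some \<open>a\<close> splits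
    \<open>q\<close> modulo \<open>p\<close>, and the factor sets of both parts are joined; or every
    such gcd is trivial, and \<open>q\<close> is its own only factor.\<close>
  consider "degree q = 0"
    | a h s t w where "lead_coeff h = 1" "h = a * s + q * t + [:p:] * w" "dvd_mod p h a"
      "dvd_mod p h q" "0 < degree h" "degree h < degree q"
    | "degree q > 0" "\<And>a h s t w. lead_coeff h = 1 \<Longrightarrow> h = a * s + q * t + [:p:] * w \<Longrightarrow> dvd_mod p h a
      \<Longrightarrow> dvd_mod p h q \<Longrightarrow> degree h = 0 \<or> degree h \<ge> degree q"
    by (metis (full_types) gr0I not_less)
  then show ?case
  proof cases
    case 1
    then have "q = 1" using less.prems by (metis degree_0_id of_int_hom.hom_one one_pCons)
    then have "comax_mod p a q" for a
      unfolding comax_mod_def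
      by (intro exI[of _ 0] exI[of _ 1] exI[of _ 0]) auto
    then show ?thesis by (intro exI[of _ "{}"]) auto
  next
    case (2 a h s t w)
    obtain e where e: "q = h * e + monic_rem h q"
      "monic_rem h q = 0 \<or> degree (monic_rem h q) < degree h"
      using monic_rem[OF 2(1)] by blast
    obtain y where y: "monic_rem h q = [:p:] * y"
      using dvd_mod_monic_rem[OF 2(1,4)] by blast
    have qe: "q = h * e + [:p:] * y" using e(1) y by simp
    have e0: "e \<noteq> 0" using e 2 by auto
    have h0: "h \<noteq> 0" using 2(1) by auto
    have dhe: "degree (h * e) = degree h + degree e" using h0 e0 by (rule degree_mult_eq)
    have sm: "degree (monic_rem h q) < degree (h * e)" using e(2) 2(5) dhe by auto
    have dq: "degree q = degree h + degree e"
      using degree_add_eq_left[OF sm] dhe e(1) by simp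
    have "lead_coeff q = lead_coeff (h * e)"
      using e(1) lead_coeff_add_le[OF sm] by (metis add.commute)
    then have le: "lead_coeff e = 1" using less.prems 2(1) by (simp add: lead_coeff_mult)
    obtain G1 where G1: "finite G1" "card G1 \<le> degree h"
      "\<forall>g\<in>G1. lead_coeff g = 1 \<and> degree g \<ge> 1 \<and> dvd_mod p g h"
      "\<forall>a. (\<exists>g\<in>G1. dvd_mod p g a) \<or> comax_mod p a h"
      using less.hyps[OF 2(6,1)] by blast
    have "degree e < degree q" using dq 2(5) by simp
    then obtain G2 where G2: "finite G2" "card G2 \<le> degree e"
      "\<forall>g\<in>G2. lead_coeff g = 1 \<and> degree g \<ge> 1 \<and> dvd_mod p g e"
      "\<forall>a. (\<exists>g\<in>G2. dvd_mod p g a) \<or> comax_mod p a e"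
      using less.hyps[of e] le by blast
    have eq: "dvd_mod p e q" unfolding dvd_mod_def using qe by (metis mult.commute)
    show ?thesis
    proof (intro exI[of _ "G1 \<union> G2"] conjI ballI allI)
      show "finite (G1 \<union> G2)" using G1 G2 by auto
      show "card (G1 \<union> G2) \<le> degree q" using card_Un_le[of G1 G2] G1(2) G2(2) dq by linarith
      fix g assume "g \<in> G1 \<union> G2"
      then show "lead_coeff g = 1" "degree g \<ge> 1" "dvd_mod p g q"
        using G1(3) G2(3) dvd_mod_trans 2(4) eq by blast+
    next
      fix b
      show "(\<exists>g\<in>G1 \<union> G2. dvd_mod p g b) \<or> comax_mod p b q"
        using G1(4) G2(4) comax_mod_mult[OF _ _ qe] by blast
    qed
  next
    case 3
    have "dvd_mod p q a \<or> comax_mod p a q" for a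
    proof -
      obtain h s t w where h: "lead_coeff h = 1" "h = a * s + q * t + [:p:] * w" "dvd_mod p h a"
        "dvd_mod p h q"
        using euclid_mod[OF p less.prems] by blast
      from 3(2)[OF h] show ?thesis
      proof
        assume "degree h = 0"
        then have "h = 1" using h(1) by (metis degree_0_id of_int_hom.hom_one one_pCons)
        then show ?thesis using h(2) unfolding comax_mod_def by metis
      next
        \<comment> \<open>Here the monic \<open>h\<close> divides the monic \<open>q\<close> modulo
          \<open>p\<close> without having smaller degree, so the cofactor \<open>e\<close> is 1 and
          \<open>q\<close> in turn divides \<open>h\<close>, hence \<open>a\<close>, modulo
          \<open>p\<close>.\<close>
        assume ge: "degree h \<ge> degree q"
        obtain e where e: "q = h * e + monic_rem h q"
          "monic_rem h q = 0 \<or> degree (monic_rem h q) < degree h"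
          using monic_rem[OF h(1)] by blast
        obtain y where y: "monic_rem h q = [:p:] * y"
          using dvd_mod_monic_rem[OF h(1,4)] by blast
        have h0: "h \<noteq> 0" using h(1) by auto
        have dh: "degree h > 0" using ge 3(1) by simp
        have e0: "e \<noteq> 0"
        proof
          assume "e = 0"
          then have "q = [:p:] * y" using e y by simp
          then have "lead_coeff q = p * lead_coeff y" by simp
          then have "1 = p * lead_coeff y" using less.prems by simp
          then show False using p by (metis dvd_triv_left not_prime_unit)
        qed
        have dhe: "degree (h * e) = degree h + degree e" using h0 e0 by (rule degree_mult_eq)
        have sm: "degree (monic_rem h q) < degree (h * e)" using e(2) dh dhe by auto
        have dq: "degree q = degree h + degree e"
          using degree_add_eq_left[OF sm] dhe e(1) by simp
        have "lead_coeff q = lead_coeff (h * e)"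
          using e(1) lead_coeff_add_le[OF sm] by (metis add.commute)
        then have le: "lead_coeff e = 1" using less.prems h(1) by (simp add: lead_coeff_mult)
        have "degree e = 0" using dq ge by simp
        then have "e = 1" using le by (metis degree_0_id of_int_hom.hom_one one_pCons)
        then have "h = q * 1 + [:p:] * (- y)" using e(1) y by simp
        then have "dvd_mod p q h" unfolding dvd_mod_def by blast
        then show ?thesis using dvd_mod_trans h(3) by blast
      qed
    qed
    then show ?thesis using 3(1) less.prems
      by (intro exI[of _ "{q}"]) (auto intro: dvd_mod_refl)
  qed
qed

section \<open>Lattice points in boxes\<close>

definition box :: "nat \<Rightarrow> nat \<Rightarrow> int poly set" where
  "box n Z = {a. (\<forall>i<n. coeff a i \<in> {0..<int Z}) \<and> (\<forall>i\<ge>n. coeff a i = 0)}"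

lemma box_0: "box 0 Z = {0}"
  by (auto simp: box_def poly_eq_iff)

lemma box_Suc: "box (Suc n) Z = (\<lambda>(x, t). pCons x t) ` ({0..<int Z} \<times> box n Z)"
proof (rule Set.set_eqI)
  fix a :: "int poly"
  obtain x t where a: "a = pCons x t" by (cases a)
  have all: "(\<forall>i<Suc n. Q i) \<longleftrightarrow> Q 0 \<and> (\<forall>i<n. Q (Suc i))" for Q :: "nat \<Rightarrow> bool"
    using less_Suc_eq_0_disj by auto
  have all': "(\<forall>i\<ge>Suc n. Q i) \<longleftrightarrow> (\<forall>i\<ge>n. Q (Suc i))" for Q :: "nat \<Rightarrow> bool"
    using Suc_le_D by blast
  show "a \<in> box (Suc n) Z \<longleftrightarrow> a \<in> (\<lambda>(x, t). pCons x t) ` ({0..<int Z} \<times> box n Z)"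
    unfolding a box_def all all' mem_Collect_eq by (auto simp: image_iff)
qed

lemma box_card: "finite (box n Z) \<and> card (box n Z) = Z ^ n"
proof (induction n)
  case (Suc n)
  have "inj_on (\<lambda>(x, t). pCons x t) ({0..<int Z} \<times> box n Z)"
    by (auto simp: inj_on_def)
  then show ?case unfolding box_Suc using Suc by (simp add: card_image)
qed (simp add: box_0)

lemma box_degree: "a \<in> box n Z \<Longrightarrow> n > 0 \<Longrightarrow> degree a < n"
  unfolding box_def by (metis (mono_tags, lifting) degree_0 leI leading_coeff_0_iff mem_Collect_eq)

text \<open>Cut the box into cells of side \<open>L\<close>: two points of \<open>X\<close> in one
  cell coincide by the separation hypothesis.\<close>

lemma box_packing:
  assumes "X \<subseteq> box n Z" "L > 0"
    and "\<And>a b. a \<in> X \<Longrightarrow> b \<in> X \<Longrightarrow> (\<And>i. \<bar>coeff (a - b) i\<bar> \<le> int L - 1) \<Longrightarrow> a = b"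
  shows "card X \<le> (Z div L + 1) ^ n"
proof -
  let ?c = "map_poly (\<lambda>x. x div int L)"
  have c: "coeff (?c a) i = coeff a i div int L" for a i
    by (rule coeff_map_poly) simp
  have "inj_on ?c X"
  proof (rule inj_onI)
    fix a b assume ab: "a \<in> X" "b \<in> X" "?c a = ?c b"
    have "\<bar>coeff (a - b) i\<bar> \<le> int L - 1" for i
    proof -
      have "coeff a i div int L = coeff b i div int L" using ab(3) c by metis
      then have "coeff a i - coeff b i = coeff a i mod int L - coeff b i mod int L"
        by (metis add_diff_cancel_left mult_div_mod_eq)
      moreover have "0 \<le> coeff a i mod int L" "coeff a i mod int L < int L"
        "0 \<le> coeff b i mod int L" "coeff b i mod int L < int L"
        using assms(2) by auto
      ultimately show ?thesis unfolding coeff_diff by linarith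
    qed
    then show "a = b" using assms(3) ab by blast
  qed
  moreover have "?c ` X \<subseteq> box n (Z div L + 1)"
  proof
    fix b assume "b \<in> ?c ` X"
    then obtain a where a: "a \<in> box n Z" "b = ?c a" using assms(1) by auto
    have "coeff b i \<in> {0..<int (Z div L + 1)}" if "i < n" for i
    proof -
      have i: "0 \<le> coeff a i" "coeff a i < int Z" using a that by (auto simp: box_def)
      have "coeff a i div int L \<le> int Z div int L" by (rule zdiv_mono1) (use i assms(2) in auto)
      then show ?thesis using i(1) assms(2) a(2) c[of a i]
        by (simp add: zdiv_int pos_imp_zdiv_nonneg_iff)
    qed
    moreover have "coeff b i = 0" if "i \<ge> n" for i
      using a that c[of a i] by (simp add: box_def)
    ultimately show "b \<in> box n (Z div L + 1)" unfolding box_def by blast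
  qed
  ultimately show ?thesis
    using card_inj_on_le[of ?c X "box n (Z div L + 1)"] box_card by auto
qed

section \<open>Primes modulo which a polynomial has a root\<close>

definition root_primes :: "int poly \<Rightarrow> nat set" where
  "root_primes P = {p. prime p \<and> (\<exists>x. int p dvd poly P x)}"

text \<open>Divergence of the sum of reciprocals, in the form with finite subsets that both counting
  arguments use.\<close>

definition unbounded_reciprocals :: "nat set \<Rightarrow> bool" where
  "unbounded_reciprocals S \<longleftrightarrow> (\<forall>C::real. \<exists>F\<subseteq>S. finite F \<and> (\<Sum>p\<in>F. 1 / real p) > C)"

lemma unbounded_reciprocals_cofinite:
  assumes S: "unbounded_reciprocals S" and ST: "\<And>p. p \<in> S \<Longrightarrow> p > N \<Longrightarrow> p \<in> T"
  shows "unbounded_reciprocals T"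
  unfolding unbounded_reciprocals_def
proof
  fix C :: real
  obtain F0 where F0: "F0 \<subseteq> S" "finite F0" "(\<Sum>p\<in>F0. 1 / real p) > C + real (card {..N})"
    using S unfolding unbounded_reciprocals_def by blast
  define F where "F = {p\<in>F0. p > N}"
  have finF: "finite F" unfolding F_def using F0 by simp
  have "(\<Sum>p\<in>F0. 1 / real p) \<le> (\<Sum>p\<in>F \<union> {..N}. 1 / real p)"
    by (rule sum_mono2) (use finF in \<open>auto simp: F_def\<close>)
  also have "\<dots> = (\<Sum>p\<in>F. 1 / real p) + (\<Sum>p\<in>{..N}. 1 / real p)"
    by (rule sum.union_disjoint) (use finF in \<open>auto simp: F_def\<close>)
  also have "(\<Sum>p\<in>{..N}. 1 / real p) \<le> (\<Sum>p\<in>{..N}. 1)"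
  proof (rule sum_mono)
    fix p show "1 / real p \<le> 1" by (cases "p = 0") auto
  qed
  finally have "(\<Sum>p\<in>F. 1 / real p) > C" using F0(3) by simp
  moreover have "F \<subseteq> T" using F0(1) ST unfolding F_def by auto
  ultimately show "\<exists>F\<subseteq>T. finite F \<and> (\<Sum>p\<in>F. 1 / real p) > C" using finF by blast
qed

text \<open>Telescoping with 1/(n+1)^2 \<le> 1/n - 1/(n+1).\<close>

lemma sum_inverse_squares_le:
  assumes "m > 0"
  shows "(\<Sum>q\<in>{m<..n}. 1 / real q ^ 2) \<le> 1 / real m"
proof (cases "m \<le> n")
  case True
  then have "(\<Sum>q\<in>{m<..n}. 1 / real q ^ 2) \<le> 1 / real m - 1 / real n"
  proof (induction n rule: dec_induct)
    case (step n)
    have n: "n > 0" using step assms by simp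
    have "{m<..Suc n} = insert (Suc n) {m<..n}" using step by auto
    then have "(\<Sum>q\<in>{m<..Suc n}. 1 / real q ^ 2) = 1 / real (Suc n) ^ 2 + (\<Sum>q\<in>{m<..n}. 1 / real q ^ 2)"
      by simp
    also have "1 / real (Suc n) ^ 2 \<le> 1 / real n - 1 / real (Suc n)"
    proof -
      have "1 / real n - 1 / real (Suc n) = 1 / (real n * real (Suc n))"
        using n by (simp add: field_simps)
      moreover have "1 / real (Suc n) ^ 2 \<le> 1 / (real n * real (Suc n))"
        using n by (intro divide_left_mono) (auto simp: power2_eq_square intro!: mult_right_mono)
      ultimately show ?thesis by simp
    qed
    finally show ?case using step by linarith
  qed simp
  also have "\<dots> \<le> 1 / real m" by simp
  finally show ?thesis .
qed simp

section \<open>A sieve on the norms of 1 + M b\<close>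

context irreducible_monic_poly
begin

text \<open>Nonnegative coefficients of \<open>b\<close> give 1 + M b a positive constant
  coefficient; so it is nonzero, and its norm too.\<close>

lemma one_plus_smult_box:
  assumes bb: "b \<in> box d Z" and M: "M > 0" and Z: "Z > 0"
  shows "degree (1 + smult (int M) b) < d" "pnorm P (1 + smult (int M) b) \<noteq> 0"
    "\<bar>coeff (1 + smult (int M) b) i\<bar> \<le> 2 * int M * int Z"
proof -
  let ?a = "1 + smult (int M) b"
  have db: "degree b < d" using box_degree[OF bb deg_pos] .
  show da: "degree ?a < d" using db deg_pos
    by (intro degree_add_less) (auto intro: le_less_trans[OF degree_smult_le])
  have "coeff b 0 \<ge> 0" using bb deg_pos by (auto simp: box_def)
  then have "coeff ?a 0 > 0" by (simp add: add_pos_nonneg)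
  then have "?a \<noteq> 0" by (metis coeff_0 less_irrefl)
  then show "pnorm P ?a \<noteq> 0" using pnorm_nonzero da by blast
  have "0 \<le> coeff b i" "coeff b i \<le> int Z - 1" using bb Z by (cases "i < d"; force simp: box_def)+
  then have "0 \<le> int M * coeff b i" "int M * coeff b i \<le> int M * (int Z - 1)"
    by (auto intro: mult_left_mono)
  moreover have "\<bar>coeff 1 i\<bar> \<le> (1::int)" "coeff 1 i \<ge> (0 :: int)" by (auto simp: coeff_1)
  moreover have "1 + int M * (int Z - 1) \<le> 2 * int M * int Z"
  proof -
    have "int M * int Z \<ge> 0" "int M \<ge> 1" using M by auto
    then have "1 + (int M * int Z - int M) \<le> 2 * (int M * int Z)" by linarith
    then show ?thesis by (simp only: right_diff_distrib mult_1_right mult.assoc)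
  qed
  ultimately show "\<bar>coeff ?a i\<bar> \<le> 2 * int M * int Z" unfolding coeff_add coeff_smult by linarith
qed

lemma pnorm_dvd_mod:
  assumes "lead_coeff g = 1" "degree g \<le> d" "dvd_mod m g a" "dvd_mod m g P"
  shows "m ^ degree g dvd pnorm P a"
  using assms(3,4) pnorm_dvd[OF assms(1,2)] unfolding dvd_mod_def by auto

text \<open>Combined with \<open>factors_mod\<close>: a prime dividing the norm of \<open>a\<close>
  forces some irreducible factor of \<open>P\<close> modulo that prime to divide
  \<open>a\<close>.\<close>

lemma pnorm_comax_mod:
  assumes "comax_mod m a P" and "m dvd pnorm P a"
  shows "m dvd 1"
proof -
  obtain s t w where "a * s + P * t + smult m w = 1"
    using assms(1) unfolding comax_mod_def by auto
  then have "[pnorm P a * pnorm P s = 1] (mod m)" by (rule pnorm_coprime)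
  then show ?thesis using assms(2) by (metis cong_dvd_iff dvd_mult2)
qed

lemma dvd_mod_degree_le:
  assumes p: "\<not> p dvd 1" and g: "lead_coeff g = 1" and "dvd_mod p g P"
  shows "degree g \<le> d"
proof (rule ccontr)
  assume "\<not> degree g \<le> d"
  then have "monic_rem g P = P" by (intro monic_rem_unique[OF g, of _ 0]) auto
  then obtain y where "P = [:p:] * y" using dvd_mod_monic_rem[OF g assms(3)] by metis
  then have "lead_coeff P = p * lead_coeff y" by simp
  then show False using monic p by (metis dvd_triv_left)
qed

text \<open>\<open>X\<close> lies in one coset of the lattice of polynomials divisible by
  \<open>g\<close> modulo \<open>p\<close>. Nonzero lattice elements of degree below
  \<open>d\<close> have norm at least p^f in absolute value, so the points are far apart and packing
  applies. The constant depending on \<open>M\<close> enters only for p > Z, so that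
  \<open>Z\<close> can later be chosen in terms of \<open>M\<close>.\<close>

lemma card_lattice_coset_le:
  fixes C :: int and M p Z :: nat
  assumes C: "C > 0" "\<And>a k. degree a < d \<Longrightarrow> (\<And>i. \<bar>coeff a i\<bar> \<le> k) \<Longrightarrow> \<bar>pnorm P a\<bar> \<le> C * k ^ d"
    and p: "prime p" "coprime p M" and M: "M > 0" and Z: "Z > 0"
    and g: "lead_coeff g = 1" "degree g \<ge> 1" "dvd_mod (int p) g P"
    and X: "X = {b \<in> box d Z. dvd_mod (int p) g (1 + smult (int M) b)}"
  shows "real (card X) \<le> real Z ^ d / real p ^ degree g *
    (2 ^ d * real_of_int C + (if p > Z then real_of_int C * (2 * real M) ^ d else 0))"
proof -
  define f where "f = degree g"
  have pu: "\<not> int p dvd 1" using p(1) by (simp add: prime_nat_iff)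
  have fd: "f \<le> d" unfolding f_def using dvd_mod_degree_le[OF pu g(1,3)] .
  have ppos: "p > 0" using p(1) by (simp add: prime_gt_0_nat)
  have dvdN: "int p ^ f dvd pnorm P a" if "dvd_mod (int p) g a" for a
    unfolding f_def using pnorm_dvd_mod[OF g(1) _ that g(3)] fd f_def by simp
  have diff: "dvd_mod (int p) g (b - b')" if b: "b \<in> X" "b' \<in> X" for b b'
  proof -
    obtain e w where 1: "1 + smult (int M) b = g * e + [:int p:] * w" using b X by (auto simp: dvd_mod_def)
    obtain e' w' where 2: "1 + smult (int M) b' = g * e' + [:int p:] * w'" using b X by (auto simp: dvd_mod_def)
    \<comment> \<open>As \<open>p\<close> does not divide \<open>M\<close>, the factor
      \<open>M\<close> can be cancelled from the difference.\<close>
    have "coprime (int M) (int p)" using p(2) by (simp add: coprime_commute)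
    then obtain x y where xy: "x * int M + y * int p = 1"
      by (metis bezout_int coprime_imp_gcd_eq_1)
    have "b - b' = smult (x * int M + y * int p) (b - b')" using xy by simp
    also have "\<dots> = [:x:] * ((1 + smult (int M) b) - (1 + smult (int M) b')) + [:int p:] * ([:y:] * (b - b'))"
      by (rule poly_eqI) (simp add: algebra_simps)
    also have "\<dots> = g * ([:x:] * (e - e')) + [:int p:] * ([:x:] * (w - w') + [:y:] * (b - b'))"
      unfolding 1 2 by (simp only: ring_distribs ac_simps)
    finally show ?thesis unfolding dvd_mod_def by blast
  qed
  \<comment> \<open>Roughly p^(f/d). By minimality, lattice vectors with all coefficients at most L
    - 1 in absolute value have norm below p^f and must vanish.\<close>
  define L where "L = (LEAST L. int p ^ f \<le> C * int L ^ d)"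
  have "int p ^ f \<le> C * int (p ^ f) ^ d"
  proof -
    have "int p ^ f \<le> int (p ^ f) ^ d" 
      using self_le_power[of "int p ^ f" d] deg_pos ppos by simp
    also have "\<dots> \<le> C * int (p ^ f) ^ d" using C(1) mult_right_mono[of 1 C "int (p ^ f) ^ d"] by simp
    finally show ?thesis .
  qed
  then have L: "int p ^ f \<le> C * int L ^ d" unfolding L_def by (rule LeastI)
  have "L \<noteq> 0"
  proof
    assume "L = 0"
    then have "int p ^ f \<le> 0" using L deg_pos by (simp add: zero_power)
    then show False using zero_less_power[of "int p" f] ppos by linarith
  qed
  then have L0: "L > 0" by simp
  have L': "C * (int L - 1) ^ d < int p ^ f"
    using not_less_Least[of "L - 1" "\<lambda>L. int p ^ f \<le> C * int L ^ d"] L0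
    unfolding L_def[symmetric] by (simp add: of_nat_diff)
  have XB: "X \<subseteq> box d Z" using X by auto
  have pack: "card X \<le> (Z div L + 1) ^ d"
  proof (rule box_packing[OF XB L0])
    fix a b assume ab: "a \<in> X" "b \<in> X" "\<And>i. \<bar>coeff (a - b) i\<bar> \<le> int L - 1"
    show "a = b"
    proof (rule ccontr)
      assume "a \<noteq> b"
      moreover have dg: "degree (a - b) < d"
        using ab XB box_degree deg_pos by (intro degree_diff_less) auto
      ultimately have "pnorm P (a - b) \<noteq> 0" using pnorm_nonzero by simp
      then have "int p ^ f \<le> \<bar>pnorm P (a - b)\<bar>"
        using dvdN[OF diff[OF ab(1,2)]] dvd_imp_le_int[of "pnorm P (a - b)" "int p ^ f"] by simp
      also have "\<dots> \<le> C * (int L - 1) ^ d" using C(2) dg ab(3) by blast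
      finally show False using L' by simp
    qed
  qed
  have ppf: "real p ^ f > 0" using ppos by simp
  show ?thesis
  proof (cases "L \<le> Z")
    case True
    have "real (Z div L + 1) \<le> real Z / real L + 1" 
      by (simp add: of_nat_div_le_of_nat)
    also have "\<dots> \<le> 2 * real Z / real L" using True L0 by (simp add: field_simps)
    finally have "real (Z div L + 1) ^ d \<le> (2 * real Z / real L) ^ d" by (intro power_mono) auto
    also have "\<dots> = 2 ^ d * real Z ^ d / real L ^ d" by (simp add: power_mult_distrib power_divide)
    also have "\<dots> \<le> 2 ^ d * real Z ^ d * (real_of_int C / real p ^ f)"
    proof -
      have "real_of_int (int p ^ f) \<le> real_of_int (C * int L ^ d)" using L by (simp only: of_int_le_iff)
      then have "1 / real L ^ d \<le> real_of_int C / real p ^ f" using L0 ppf by (simp add: field_simps)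
      from mult_left_mono[OF this, of "2 ^ d * real Z ^ d"] show ?thesis by simp
    qed
    also have "\<dots> = real Z ^ d / real p ^ f * (2 ^ d * real_of_int C)" by simp
    also have "\<dots> \<le> real Z ^ d / real p ^ f *
        (2 ^ d * real_of_int C + (if p > Z then real_of_int C * (2 * real M) ^ d else 0))"
      using C(1) ppf by (intro mult_left_mono) auto
    finally show ?thesis using pack unfolding f_def by (meson of_nat_le_iff order.trans of_nat_power_le_of_nat_cancel_iff)
  next
    case False
    \<comment> \<open>If the single possible point \<open>b\<close> exists, the norm of 1 + M b is a
      nonzero multiple of p^f, so p^f \<le> C (2 M Z)^d and the claimed bound is at least 1.\<close>
    then have le1: "card X \<le> 1" using pack by simp
    show ?thesis
    proof (cases "X = {}")
      case True
      then show ?thesis using C(1) by (auto intro!: mult_nonneg_nonneg divide_nonneg_nonneg add_nonneg_nonneg)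
    next
      case False
      then obtain b where b: "b \<in> X" by auto
      let ?a = "1 + smult (int M) b"
      have bb: "b \<in> box d Z" using b XB by auto
      note a = one_plus_smult_box[OF bb M Z]
      have "int p ^ f \<le> \<bar>pnorm P ?a\<bar>"
        using dvdN[of ?a] b X a(2) dvd_imp_le_int[of "pnorm P ?a" "int p ^ f"] by auto
      also have "\<dots> \<le> C * (2 * int M * int Z) ^ d" by (rule C(2)[OF a(1,3)])
      finally have "real_of_int (int p ^ f) \<le> real_of_int (C * (2 * int M * int Z) ^ d)"
        by (simp only: of_int_le_iff)
      then have "1 \<le> real Z ^ d / real p ^ f * (real_of_int C * (2 * real M) ^ d)"
        using ppf by (simp add: field_simps power_mult_distrib)
      \<comment> \<open>From Z \<le> L - 1 and the minimality of \<open>L\<close>: Z^d < p^f \<le>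
        p^d.\<close>
      moreover have "p > Z"
      proof (rule ccontr)
        assume "\<not> p > Z"
        have "int Z ^ d \<le> (int L - 1) ^ d" using \<open>\<not> L \<le> Z\<close> by (intro power_mono) auto
        also have "\<dots> \<le> C * (int L - 1) ^ d"
          using C(1) L0 mult_right_mono[of 1 C "(int L - 1) ^ d"] by simp
        also have "\<dots> < int p ^ f" by (rule L')
        also have "\<dots> \<le> int p ^ d" using fd ppos by (intro power_increasing) auto
        finally have "int Z < int p" by (rule power_less_imp_less_base) simp
        then show False using \<open>\<not> p > Z\<close> by simp
      qed
      ultimately have "1 \<le> real Z ^ d / real p ^ f *
          (if p > Z then real_of_int C * (2 * real M) ^ d else 0)" by simp
      also have "\<dots> \<le> real Z ^ d / real p ^ f *
        (2 ^ d * real_of_int C + (if p > Z then real_of_int C * (2 * real M) ^ d else 0))"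
        using C(1) ppf by (intro mult_left_mono) auto
      finally show ?thesis using le1 unfolding f_def by (smt (verit) of_nat_1 of_nat_le_iff)
    qed
  qed
qed

text \<open>With the other coefficients fixed, each of the values 1 and -1 occurs for at most
  \<open>d\<close> constant coefficients.\<close>

lemma card_pnorm_unit_le:
  assumes M: "M > 0"
  shows "card {b \<in> box d Z. \<bar>pnorm P (1 + smult (int M) b)\<bar> = 1} \<le> 2 * d * Z ^ (d - 1)"
proof -
  obtain n where n: "d = Suc n" using deg_pos by (cases d) auto
  let ?U = "{b \<in> box d Z. \<bar>pnorm P (1 + smult (int M) b)\<bar> = 1}"
  define V where "V t v = {x. pnorm P (1 + smult (int M) (pCons x t)) = v}" for t v
  have V: "finite (V t v) \<and> card (V t v) \<le> d" for t v
  proof -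
    let ?c = "1 + smult (int M) (pCons 0 t)"
    have "1 + smult (int M) (pCons x t) = ?c + [:int M * x:]" for x
      by (rule poly_eqI) (auto simp: coeff_pCons split: nat.splits)
    note eq = this
    have sub: "(\<lambda>x. int M * x) ` V t v \<subseteq> {x. pnorm P (?c + [:x:]) = v}"
    proof
      fix y assume "y \<in> (\<lambda>x. int M * x) ` V t v"
      then obtain x where x: "y = int M * x" "pnorm P (1 + smult (int M) (pCons x t)) = v"
        unfolding V_def by blast
      have "pnorm P (?c + [:y:]) = v" unfolding x(1) eq[of x, symmetric] by (rule x(2))
      then show "y \<in> {x. pnorm P (?c + [:x:]) = v}" by (rule CollectI)
    qed
    have inj: "inj_on (\<lambda>x. int M * x) (V t v)" using M by (auto simp: inj_on_def)
    have fin: "finite (V t v)" by (rule finite_imageD[OF finite_subset[OF sub card_pnorm_const_shift_le(1)] inj])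
    have "card (V t v) \<le> card {x. pnorm P (?c + [:x:]) = v}"
      using card_inj_on_le[OF inj sub card_pnorm_const_shift_le(1)] .
    then show ?thesis using fin card_pnorm_const_shift_le(2)[of ?c v] by linarith
  qed
  have "?U \<subseteq> (\<Union>t\<in>box n Z. (\<lambda>x. pCons x t) ` (V t 1 \<union> V t (-1)))"
  proof
    fix b assume b: "b \<in> ?U"
    then obtain x t where "b = pCons x t" "t \<in> box n Z" unfolding n box_Suc by auto
    moreover have "pnorm P (1 + smult (int M) b) = 1 \<or> pnorm P (1 + smult (int M) b) = -1"
      using b by auto
    ultimately show "b \<in> (\<Union>t\<in>box n Z. (\<lambda>x. pCons x t) ` (V t 1 \<union> V t (-1)))"
      unfolding V_def by blast
  qed
  then have "card ?U \<le> card (\<Union>t\<in>box n Z. (\<lambda>x. pCons x t) ` (V t 1 \<union> V t (-1)))"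
    by (intro card_mono) (use V box_card in auto)
  also have "\<dots> \<le> (\<Sum>t\<in>box n Z. card ((\<lambda>x. pCons x t) ` (V t 1 \<union> V t (-1))))"
    by (rule card_UN_le) (use box_card in auto)
  also have "\<dots> \<le> (\<Sum>t\<in>box n Z. 2 * d)"
  proof (rule sum_mono)
    fix t
    have "card ((\<lambda>x. pCons x t) ` (V t 1 \<union> V t (-1))) \<le> card (V t 1 \<union> V t (-1))"
      by (rule card_image_le) (use V in auto)
    also have "\<dots> \<le> card (V t 1) + card (V t (-1))" by (rule card_Un_le)
    also have "\<dots> \<le> 2 * d" using V[of t 1] V[of t "-1"] by linarith
    finally show "card ((\<lambda>x. pCons x t) ` (V t 1 \<union> V t (-1))) \<le> 2 * d" .
  qed
  also have "\<dots> = 2 * d * Z ^ (d - 1)" using box_card n by simp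
  finally show ?thesis .
qed

text \<open>The box is covered by the \<open>b\<close> of unit norm and the sets \<open>E p\<close>;
  with bounded sums of reciprocals these would fill at most three quarters of it. The constants are
  chosen in the order \<open>P0\<close>, \<open>M\<close>, \<open>Z\<close>.\<close>

theorem unbounded_root_primes: "unbounded_reciprocals (root_primes P)"
proof (rule ccontr)
  let ?S = "root_primes P"
  assume "\<not> unbounded_reciprocals ?S"
  then obtain B where B: "\<And>F. F \<subseteq> ?S \<Longrightarrow> finite F \<Longrightarrow> (\<Sum>p\<in>F. 1 / real p) \<le> B"
    unfolding unbounded_reciprocals_def by (meson not_le)
  obtain C where C: "C > 0" "\<And>a k. degree a < d \<Longrightarrow> (\<And>i. \<bar>coeff a i\<bar> \<le> k) \<Longrightarrow> \<bar>pnorm P a\<bar> \<le> C * k ^ d"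
    using pnorm_bound by blast
  \<comment> \<open>Dominates 1/p^f for every degree f of a factor of \<open>P\<close> modulo
    \<open>p\<close>, because f = 1 requires a root.\<close>
  define w where "w p = (if p \<in> ?S then 1 / real p else 0) + 1 / real p ^ 2" for p
  have w0: "w p \<ge> 0" for p unfolding w_def by simp
  have "summable w"
    unfolding w_def
  proof (rule summable_add)
    show "summable (\<lambda>p. if p \<in> ?S then 1 / real p else 0)"
    proof (rule summableI_nonneg_bounded)
      fix n
      have "(\<Sum>p<n. if p \<in> ?S then 1 / real p else 0) = (\<Sum>p\<in>{p\<in>{..<n}. p \<in> ?S}. 1 / real p)"
        by (rule sum.inter_filter[symmetric]) simp
      also have "\<dots> \<le> B" by (rule B) auto
      finally show "(\<Sum>p<n. if p \<in> ?S then 1 / real p else 0) \<le> B" .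
    qed simp
    show "summable (\<lambda>p. 1 / real p ^ 2)"
    proof (rule summableI_nonneg_bounded)
      fix n
      have "(\<Sum>p<n. 1 / real p ^ 2) \<le> (\<Sum>p\<in>insert 0 (insert 1 {1<..n}). 1 / real p ^ 2)"
        by (rule sum_mono2) auto
      also have "\<dots> = 1 + (\<Sum>p\<in>{1<..n}. 1 / real p ^ 2)" by simp
      also have "\<dots> \<le> 2" using sum_inverse_squares_le[of 1 n] by simp
      finally show "(\<Sum>p<n. 1 / real p ^ 2) \<le> 2" .
    qed simp
  qed
  then have tail: "\<exists>N. \<forall>m\<ge>N. \<forall>n. (\<Sum>p=m..<n. w p) < e" if "e > 0" for e
    using that unfolding summable_Cauchy by (metis abs_of_nonneg real_norm_def sum_nonneg w0)
  define c1 where "c1 = real d * (2 ^ d * real_of_int C)"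
  have c1: "c1 > 0" unfolding c1_def using deg_pos C(1) by simp
  \<comment> \<open>Makes the \<open>c1\<close> part of all primes above \<open>P0\<close> at most a
    quarter of the box.\<close>
  obtain P0 where P0: "\<And>n. (\<Sum>p=P0..<n. w p) < 1 / (4 * c1)"
    using tail[of "1 / (4 * c1)"] c1 by auto
  define M :: nat where "M = fact P0"
  have M0: "M > 0" by (simp add: M_def)
  define c2 where "c2 = real d * (real_of_int C * (2 * real M) ^ d)"
  have c2: "c2 > 0" unfolding c2_def using deg_pos C(1) M0 by simp
  \<comment> \<open>\<open>c2\<close> depends on \<open>M\<close> and thus on \<open>P0\<close>, but
    it concerns only primes above \<open>Z\<close>, and \<open>Z\<close> is taken to be at least
    \<open>N\<close>.\<close>
  obtain N where N: "\<And>m n. m \<ge> N \<Longrightarrow> (\<Sum>p=m..<n. w p) < 1 / (4 * c2)"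
    using tail[of "1 / (4 * c2)"] c2 by auto
  \<comment> \<open>The bound 8 d leaves at most a quarter of the box to unit norms.\<close>
  define Z where "Z = max N (8 * d)"
  have Z0: "Z > 0" unfolding Z_def using deg_pos by simp
  \<comment> \<open>Exceeds every norm that occurs, so finitely many primes suffice for the
    cover.\<close>
  define W where "W = Suc (nat (C * (2 * int M * int Z) ^ d))"
  define E where "E p = {b \<in> box d Z. int p dvd pnorm P (1 + smult (int M) b)}" for p
  let ?U = "{b \<in> box d Z. \<bar>pnorm P (1 + smult (int M) b)\<bar> = 1}"
  let ?Q = "{p. prime p \<and> P0 < p \<and> p < W}"
  have finQ: "finite ?Q" by (rule finite_subset[of _ "{..<W}"]) auto
  have cover: "box d Z \<subseteq> ?U \<union> (\<Union>p\<in>?Q. E p)"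
  proof
    fix b assume bb: "b \<in> box d Z"
    let ?a = "1 + smult (int M) b"
    note a = one_plus_smult_box[OF bb M0 Z0]
    note nz = a(2)
    have bd: "\<bar>pnorm P ?a\<bar> \<le> C * (2 * int M * int Z) ^ d" by (rule C(2)[OF a(1,3)])
    show "b \<in> ?U \<union> (\<Union>p\<in>?Q. E p)"
    proof (cases "\<bar>pnorm P ?a\<bar> = 1")
      case False
      then obtain p' where p': "prime p'" "p' dvd pnorm P ?a"
        using nz prime_divisor_exists[of "pnorm P ?a"] by (auto simp: zdvd1_eq)
      define p where "p = nat p'"
      have pp1: "p' = int p" using prime_ge_0_int[OF p'(1)] unfolding p_def by simp
      then have "prime p" using p'(1) by simp
      note pp = pp1 this
      have "p > P0"
      proof (rule ccontr)
        assume "\<not> p > P0"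
        then have "p dvd M" unfolding M_def using pp(2) by (simp add: prime_dvd_fact_iff)
        then have "int p dvd int M" by simp
        have "[pnorm P ?a = 1] (mod (int M))" using pnorm_add_smult[of 1 "int M" b] pnorm_1 by simp
        then have "[pnorm P ?a = 1] (mod (int p))" using \<open>int p dvd int M\<close> by (rule cong_dvd_modulus)
        then have "int p dvd 1" using p'(2) pp(1) by (metis cong_dvd_iff)
        then show False using pp(2) by (simp add: prime_nat_iff)
      qed
      moreover have "p < W"
      proof -
        have "p' \<le> \<bar>pnorm P ?a\<bar>" using dvd_imp_le_int[OF nz p'(2)] prime_ge_0_int[OF p'(1)] by simp
        then show ?thesis using bd pp(1) unfolding W_def by linarith
      qed
      ultimately have "p \<in> ?Q" "b \<in> E p" using pp p'(2) bb unfolding E_def by auto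
      then show ?thesis by blast
    qed (use bb in auto)
  qed
  have Ebound: "real (card (E p)) \<le> real Z ^ d * w p * (c1 + (if p > Z then c2 else 0))" if "p \<in> ?Q" for p
  proof -
    have p: "prime p" "P0 < p" using that by auto
    have pi: "prime (int p)" using p(1) by simp
    have pu: "\<not> int p dvd 1" using p(1) by (simp add: prime_nat_iff)
    have ppos: "p > 0" using p(1) by (simp add: prime_gt_0_nat)
    have cop: "coprime p M" unfolding M_def using p
      by (meson linorder_not_le prime_dvd_fact_iff prime_imp_coprime)
    obtain G where G: "finite G" "card G \<le> d"
      "\<forall>g\<in>G. lead_coeff g = 1 \<and> degree g \<ge> 1 \<and> dvd_mod (int p) g P"
      "\<forall>a. (\<exists>g\<in>G. dvd_mod (int p) g a) \<or> comax_mod (int p) a P"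
      using factors_mod[OF pi monic] by blast
    define X where "X g = {b \<in> box d Z. dvd_mod (int p) g (1 + smult (int M) b)}" for g
    have "E p \<subseteq> (\<Union>g\<in>G. X g)"
    proof
      fix b assume "b \<in> E p"
      then have b: "b \<in> box d Z" "int p dvd pnorm P (1 + smult (int M) b)" unfolding E_def by auto
      then have "\<not> comax_mod (int p) (1 + smult (int M) b) P" using pnorm_comax_mod pu by blast
      then show "b \<in> (\<Union>g\<in>G. X g)" using G(4) b unfolding X_def by blast
    qed
    then have "card (E p) \<le> card (\<Union>g\<in>G. X g)"
      by (rule card_mono[rotated]) (use G box_card in \<open>auto simp: X_def\<close>)
    also have "\<dots> \<le> (\<Sum>g\<in>G. card (X g))" by (rule card_UN_le[OF G(1)])
    finally have "real (card (E p)) \<le> (\<Sum>g\<in>G. real (card (X g)))"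
      by (metis of_nat_le_iff of_nat_sum)
    also have "\<dots> \<le> (\<Sum>g\<in>G. real Z ^ d * w p *
        (2 ^ d * real_of_int C + (if p > Z then real_of_int C * (2 * real M) ^ d else 0)))"
    proof (rule sum_mono)
      fix g assume "g \<in> G"
      then have g: "lead_coeff g = 1" "degree g \<ge> 1" "dvd_mod (int p) g P" using G(3) by auto
      have wp: "1 / real p ^ degree g \<le> w p"
      proof (cases "degree g = 1")
        case True
        then obtain u v where "g = [:u, v:]" by (metis degree1_coeffs One_nat_def)
        then have guv: "g = [:u, 1:]" using g(1) True by (simp split: if_splits)
        obtain e y where "P = g * e + [:int p:] * y" using g(3) by (auto simp: dvd_mod_def)
        then have "poly P (- u) = int p * poly y (- u)" using guv by simp
        then have "int p dvd poly P (- u)" by simp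
        then have "p \<in> ?S" using p(1) unfolding root_primes_def by blast
        then show ?thesis using True unfolding w_def by simp
      next
        case False
        then have "real p ^ 2 \<le> real p ^ degree g" using g(2) ppos by (intro power_increasing) auto
        then have "1 / real p ^ degree g \<le> 1 / real p ^ 2" using ppos by (intro divide_left_mono) auto
        then show ?thesis unfolding w_def by (simp add: add_increasing)
      qed
      have "real (card (X g)) \<le> real Z ^ d * (1 / real p ^ degree g) *
          (2 ^ d * real_of_int C + (if p > Z then real_of_int C * (2 * real M) ^ d else 0))"
        using card_lattice_coset_le[OF C p(1) cop M0 Z0 g X_def] by simp
      also have "\<dots> \<le> real Z ^ d * w p *
          (2 ^ d * real_of_int C + (if p > Z then real_of_int C * (2 * real M) ^ d else 0))"
        using wp C(1) by (intro mult_right_mono mult_left_mono) auto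
      finally show "real (card (X g)) \<le> real Z ^ d * w p *
          (2 ^ d * real_of_int C + (if p > Z then real_of_int C * (2 * real M) ^ d else 0))" .
    qed
    also have "\<dots> = real (card G) * (real Z ^ d * w p *
        (2 ^ d * real_of_int C + (if p > Z then real_of_int C * (2 * real M) ^ d else 0)))" by simp
    also have "\<dots> \<le> real d * (real Z ^ d * w p *
        (2 ^ d * real_of_int C + (if p > Z then real_of_int C * (2 * real M) ^ d else 0)))"
      using G(2) C(1) w0[of p] by (intro mult_right_mono) (auto intro!: mult_nonneg_nonneg add_nonneg_nonneg)
    also have "\<dots> = real Z ^ d * w p * (c1 + (if p > Z then c2 else 0))"
      unfolding c1_def c2_def by (simp add: algebra_simps)
    finally show ?thesis .
  qed
  have "real Z ^ d = real (card (box d Z))" using box_card by simp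
  also have "card (box d Z) \<le> card (?U \<union> (\<Union>p\<in>?Q. E p))"
    by (rule card_mono[OF _ cover]) (use finQ box_card in \<open>auto simp: E_def\<close>)
  also have "\<dots> \<le> card ?U + card (\<Union>p\<in>?Q. E p)" by (rule card_Un_le)
  also have "\<dots> \<le> card ?U + (\<Sum>p\<in>?Q. card (E p))" using card_UN_le[OF finQ] by simp
  finally have main: "real Z ^ d \<le> real (card ?U) + (\<Sum>p\<in>?Q. real (card (E p)))" by simp
  have U: "real (card ?U) \<le> real Z ^ d / 4"
  proof -
    obtain n where n: "d = Suc n" using deg_pos by (cases d) auto
    have "card ?U \<le> 2 * d * Z ^ n" using card_pnorm_unit_le[OF M0, of Z] n by simp
    then have "4 * card ?U \<le> 8 * d * Z ^ n" by simp
    also have "\<dots> \<le> Z * Z ^ n" unfolding Z_def by (intro mult_right_mono) auto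
    finally have "4 * card ?U \<le> Z ^ d" using n by simp
    then have "real (4 * card ?U) \<le> real (Z ^ d)" by (simp only: of_nat_le_iff)
    then show ?thesis by simp
  qed
  have "(\<Sum>p\<in>?Q. real (card (E p))) \<le> (\<Sum>p\<in>?Q. real Z ^ d * w p * (c1 + (if p > Z then c2 else 0)))"
    by (rule sum_mono[OF Ebound])
  also have "\<dots> = real Z ^ d * (c1 * (\<Sum>p\<in>?Q. w p) + c2 * (\<Sum>p\<in>?Q. if p > Z then w p else 0))"
    unfolding sum_distrib_left sum.distrib[symmetric]
    by (rule sum.cong) (auto simp: algebra_simps)
  also have "\<dots> \<le> real Z ^ d * (c1 * (1 / (4 * c1)) + c2 * (1 / (4 * c2)))"
  proof (intro mult_left_mono add_mono)
    have "(\<Sum>p\<in>?Q. w p) \<le> (\<Sum>p=P0..<W. w p)" by (rule sum_mono2) (auto intro: w0)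
    then show "(\<Sum>p\<in>?Q. w p) \<le> 1 / (4 * c1)" using P0[of W] by simp
    have "(\<Sum>p\<in>?Q. if p > Z then w p else 0) = (\<Sum>p\<in>{p\<in>?Q. p > Z}. w p)"
      by (rule sum.inter_filter[symmetric, OF finQ])
    also have "\<dots> \<le> (\<Sum>p=Z..<W. w p)" by (rule sum_mono2) (auto intro: w0)
    finally show "(\<Sum>p\<in>?Q. if p > Z then w p else 0) \<le> 1 / (4 * c2)" using N[of Z W] Z_def by simp
  qed (use c1 c2 in auto)
  also have "\<dots> = real Z ^ d / 2" using c1 c2 by simp
  finally have "real Z ^ d \<le> real Z ^ d / 4 + real Z ^ d / 2" using main U by linarith
  moreover have "real Z ^ d > 0" using Z0 by simp
  ultimately show False by linarith
qed

end

section \<open>Primes modulo which a polynomial has two roots\<close>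

definition two_root_primes :: "int poly \<Rightarrow> nat set" where
  "two_root_primes P = {p. prime p \<and>
    (\<exists>x y. int p dvd poly P x \<and> int p dvd poly P y \<and> \<not> int p dvd x - y)}"

lemma dvd_mod_linear:
  assumes "m dvd poly a r"
  shows "dvd_mod m [:- r, 1:] a"
proof -
  obtain k where "poly a r = m * k" using assms by (auto simp: dvd_def)
  then have "a = [:- r, 1:] * synthetic_div a r + [:m:] * [:k:]"
    using synthetic_div_correct'[of r a] by (simp add: mult.commute[of k])
  then show ?thesis unfolding dvd_mod_def by blast
qed

text \<open>Dividing by x - r modulo \<open>p\<close> leaves a quotient that vanishes at
  \<open>s\<close>, since \<open>p\<close> does not divide s - r.\<close>

lemma dvd_mod_two_roots:
  fixes p :: int
  assumes p: "prime p" and a: "p dvd poly a r" "p dvd poly a s" and rs: "\<not> p dvd r - s"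
  shows "dvd_mod p ([:- r, 1:] * [:- s, 1:]) a"
proof -
  define e where "e = synthetic_div a r"
  obtain k where k: "poly a r = p * k" using a(1) by (auto simp: dvd_def)
  have ae: "a = [:- r, 1:] * e + [:p:] * [:k:]"
    using synthetic_div_correct'[of r a] k unfolding e_def by (simp add: mult.commute[of k])
  have "poly a s = (s - r) * poly e s + p * k"
    using arg_cong[OF ae, of "\<lambda>b. poly b s"] by (simp add: algebra_simps)
  then have "p dvd (s - r) * poly e s" using a(2) by (metis dvd_add_left_iff dvd_triv_left)
  then have "p dvd poly e s" using p rs by (metis dvd_diff_commute prime_dvd_multD)
  then obtain e' w where e': "e = [:- s, 1:] * e' + [:p:] * w"
    using dvd_mod_linear unfolding dvd_mod_def by blast
  have "a = [:- r, 1:] * [:- s, 1:] * e' + [:p:] * ([:- r, 1:] * w + [:k:])"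
    unfolding ae e' by (simp only: ring_distribs ac_simps)
  then show ?thesis unfolding dvd_mod_def by blast
qed

section \<open>Squarefree moduli and squarefree numbers in progressions\<close>

lemma squarefree_dvd_int:
  fixes n :: nat and x :: int
  assumes n: "squarefree n" and q: "\<And>q. prime q \<Longrightarrow> q dvd n \<Longrightarrow> int q dvd x"
  shows "int n dvd x"
proof (cases "x = 0")
  case False
  have n0: "n \<noteq> 0" using n by (metis not_squarefree_0)
  have "n dvd nat \<bar>x\<bar>"
  proof (rule multiplicity_le_imp_dvd[OF n0])
    fix p :: nat assume p: "prime p"
    show "multiplicity p n \<le> multiplicity p (nat \<bar>x\<bar>)"
    proof (cases "p dvd n")
      case True
      have "multiplicity p n \<le> 1"
      proof (rule ccontr)
        assume "\<not> multiplicity p n \<le> 1"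
        then have "p ^ 2 dvd n" by (intro multiplicity_dvd') simp
        then have "is_unit p" using n by (meson squarefreeD)
        then show False using p by simp
      qed
      moreover have "p dvd nat \<bar>x\<bar>" using q[OF p True] by (metis int_dvd_int_iff abs_ge_zero dvd_abs_iff nat_0_le)
      then have "multiplicity p (nat \<bar>x\<bar>) \<ge> 1"
        using p False by (intro multiplicity_geI) (auto simp: prime_gt_1_nat)
      ultimately show ?thesis by simp
    next
      case False
      then show ?thesis by (simp add: not_dvd_imp_multiplicity_0)
    qed
  qed
  then show ?thesis by (metis int_dvd_int_iff abs_ge_zero dvd_abs_iff nat_0_le)
qed auto

lemma crt_int:
  fixes A :: "nat set" and u :: "nat \<Rightarrow> int"
  assumes A: "finite A" "\<And>q. q \<in> A \<Longrightarrow> prime q"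
  obtains r :: int where "\<And>q. q \<in> A \<Longrightarrow> [r = u q] (mod int q)"
proof -
  have cop: "\<forall>i\<in>A. \<forall>j\<in>A. i \<noteq> j \<longrightarrow> coprime i j" using A(2) by (simp add: primes_coprime)
  obtain x :: nat where x: "\<forall>i\<in>A. [x = nat (u i mod int i)] (mod i)"
    using chinese_remainder_nat[of A "\<lambda>i. i" "\<lambda>i. nat (u i mod int i)"] A(1) cop by blast
  have "[int x = u q] (mod int q)" if "q \<in> A" for q
  proof -
    have "q > 0" using A(2)[OF that] by (simp add: prime_gt_0_nat)
    then have "int (nat (u q mod int q)) = u q mod int q" by simp
    moreover have "[int x = int (nat (u q mod int q))] (mod int q)" using x that by (simp only: cong_int_iff)
    ultimately show ?thesis by (simp only: cong_def mod_mod_trivial)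
  qed
  then show ?thesis using that by blast
qed

lemma poly_cong_int: "[x = y] (mod m) \<Longrightarrow> [poly a x = poly a y] (mod (m :: int))"
  by (induction a) (auto intro!: cong_add cong_mult)

lemma card_cong_interval_le:
  fixes u L m :: nat
  assumes A: "A \<subseteq> {u..<u + L}" and m: "m > 0"
    and c: "\<And>x y. x \<in> A \<Longrightarrow> y \<in> A \<Longrightarrow> [x = y] (mod m)"
  shows "card A \<le> L div m + 1"
proof -
  have "inj_on (\<lambda>x. (x - u) div m) A"
  proof (rule inj_onI)
    fix x y assume xy: "x \<in> A" "y \<in> A" "(x - u) div m = (y - u) div m"
    have u: "x \<ge> u" "y \<ge> u" using xy A by auto
    have "[(x - u) + u = (y - u) + u] (mod m)" using c[OF xy(1,2)] u by simp
    then have "[x - u = y - u] (mod m)" by (simp only: cong_add_rcancel_nat)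
    then have "x - u = y - u" using xy(3) unfolding cong_def by (metis div_mult_mod_eq)
    then show "x = y" using u by simp
  qed
  moreover have "(\<lambda>x. (x - u) div m) ` A \<subseteq> {..L div m}"
  proof
    fix y assume "y \<in> (\<lambda>x. (x - u) div m) ` A"
    then obtain x where "x \<in> A" "y = (x - u) div m" by blast
    moreover from this have "x - u \<le> L" using A by fastforce
    ultimately show "y \<in> {..L div m}" by (simp add: div_le_mono)
  qed
  ultimately have "card A \<le> card {..L div m}" by (intro card_inj_on_le) auto
  then show ?thesis by simp
qed

lemma card_dvd_progression_le:
  fixes u L m M :: nat
  assumes "coprime m M" and m: "m > 0" and A: "A \<subseteq> {t\<in>{u..<u + L}. m dvd 1 + M * t}"
  shows "card A \<le> L div m + 1"
proof (rule card_cong_interval_le[OF _ m])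
  show "A \<subseteq> {u..<u + L}" using A by auto
  fix x y assume "x \<in> A" "y \<in> A"
  then have "m dvd 1 + M * x" "m dvd 1 + M * y" using A by auto
  then have "[1 + M * x = 1 + M * y] (mod m)" by (metis cong_0_iff cong_sym cong_trans)
  then have "[M * x = M * y] (mod m)" by (simp only: cong_add_lcancel_nat)
  then show "[x = y] (mod m)" using assms(1) by (simp add: cong_mult_lcancel_nat coprime_commute)
qed

text \<open>Take n = p (1 + M t): as M = B!, all prime factors of 1 + M t exceed \<open>B\<close>.
  Sieve out the t for which \<open>p\<close>, or q^2 with q > B prime, divides 1 + M t. Since p > B
  \<ge> 4, at least half of the interval survives, up to an error of order sqrt Y.\<close>

lemma card_squarefree_ge:
  fixes B p Y :: nat
  defines "M \<equiv> fact B"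
  assumes B: "B \<ge> 4" and p: "prime p" "p > B" and Y: "sqrt (real Y) \<ge> 32 * real p * real M"
  shows "real (card {n. squarefree n \<and> Y < 2 * n \<and> n \<le> Y \<and> p dvd n \<and> (\<forall>q. prime q \<longrightarrow> q dvd n \<longrightarrow> q > B)})
    \<ge> real Y / (16 * real p * real M)"
proof -
  let ?G = "{n. squarefree n \<and> Y < 2 * n \<and> n \<le> Y \<and> p dvd n \<and> (\<forall>q. prime q \<longrightarrow> q dvd n \<longrightarrow> q > B)}"
  have M0: "M > 0" unfolding M_def by simp
  have p0: "p > 0" using p(1) by (simp add: prime_gt_0_nat)
  have copM: "coprime q M" if "prime q" "q > B" for q
    unfolding M_def using that by (meson linorder_not_le prime_dvd_fact_iff prime_imp_coprime)
  \<comment> \<open>\<open>L\<close> and \<open>u\<close> are chosen such that p (1 + M t) lies in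
    (Y/2, Y] for t in \<open>I\<close>.\<close>
  define L where "L = Y div (4 * p * M)"
  define u where "u = Suc (Y div (2 * p * M))"
  define s where "s = nat \<lfloor>sqrt (real Y)\<rfloor>"
  define I where "I = {u..<u + L}"
  define D where "D m = {t\<in>I. m dvd 1 + M * t}" for m
  have sqY: "sqrt (real Y) ^ 2 = real Y" by simp
  have sq1: "sqrt (real Y) \<ge> 32"
  proof -
    have "real p * real M \<ge> 1" using p0 M0 by (metis One_nat_def Suc_leI nat_0_less_mult_iff of_nat_1 of_nat_le_iff of_nat_mult)
    then show ?thesis using Y by linarith
  qed
  have Y4: "4 * p \<le> Y"
  proof -
    have "4 * real p \<le> 32 * real p * real M"
      using M0 p0 by (simp add: mult_le_cancel_left1 Suc_leI) 
    also have "\<dots> \<le> sqrt (real Y)" by (rule Y)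
    also have "\<dots> \<le> sqrt (real Y) * sqrt (real Y)" using sq1 mult_left_mono[of 1 "sqrt (real Y)" "sqrt (real Y)"] by linarith
    finally have "real (4 * p) \<le> real Y" by simp
    then show ?thesis by (simp only: of_nat_le_iff)
  qed
  have rng: "Y < 2 * (p * (1 + M * t))" "p * (1 + M * t) \<le> Y" if "t \<in> I" for t
  proof -
    have "Y < 2 * p * M * u" unfolding u_def using p0 M0
      by (simp add: dividend_less_times_div)
    also have "\<dots> \<le> 2 * p * M * t" using that unfolding I_def by simp
    finally show "Y < 2 * (p * (1 + M * t))" by (simp add: algebra_simps)
    have "t \<le> Y div (2 * p * M) + L" using that unfolding I_def u_def by simp
    then have "4 * p * M * t \<le> 4 * p * M * (Y div (2 * p * M) + L)" by simp
    also have "\<dots> = 2 * (2 * p * M * (Y div (2 * p * M))) + 4 * p * M * (Y div (4 * p * M))"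
      unfolding L_def by (simp add: algebra_simps)
    also have "\<dots> \<le> 2 * Y + Y" by (intro add_mono mult_left_mono) auto
    finally have "4 * p * M * t \<le> 3 * Y" by simp
    then show "p * (1 + M * t) \<le> Y" using Y4 by (simp add: algebra_simps)
  qed
  have finI: "finite I" unfolding I_def by simp
  \<comment> \<open>Outside \<open>D p\<close> the factors \<open>p\<close> and 1 + M t are coprime;
    outside the other sets 1 + M t is squarefree.\<close>
  let ?bad = "D p \<union> (\<Union>q\<in>{q\<in>{B<..s}. prime q}. D (q ^ 2))"
  have good: "p * (1 + M * t) \<in> ?G" if t: "t \<in> I - ?bad" for t
  proof -
    let ?m = "1 + M * t"
    have qB: "q > B" if "prime q" "q dvd ?m" for q
    proof (rule ccontr)
      assume "\<not> q > B"
      then have "q dvd M" unfolding M_def using that by (simp add: prime_dvd_fact_iff)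
      then have "q dvd 1" using that(2) by (metis dvd_add_left_iff dvd_mult2)
      then show False using that(1) by simp
    qed
    have "squarefree ?m"
    proof (rule squarefreeI)
      fix x assume x: "x ^ 2 dvd ?m"
      show "is_unit x"
      proof (rule ccontr)
        assume "\<not> is_unit x"
        then obtain q where q: "prime q" "q dvd x" by (metis prime_factor_nat nat_dvd_1_iff_1)
        then have q2: "q ^ 2 dvd ?m" using x by (meson dvd_power_same dvd_trans)
        then have "q dvd ?m" by (metis dvd_trans dvd_triv_left power2_eq_square)
        then have "q > B" using qB q(1) by blast
        have "q ^ 2 \<le> ?m" using q2 by (intro dvd_imp_le) auto
        also have "\<dots> \<le> p * ?m" using p0 mult_right_mono[of 1 p ?m] by simp
        also have "\<dots> \<le> Y" using rng(2) t by blast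
        finally have "real (q ^ 2) \<le> real Y" by (simp only: of_nat_le_iff)
        then have "real q \<le> sqrt (real Y)" by (simp add: real_le_rsqrt)
        then have "q \<le> s" unfolding s_def by (simp add: le_nat_iff le_floor_iff)
        then have "t \<in> ?bad" using q2 q(1) t \<open>q > B\<close> unfolding D_def by auto
        then show False using t by blast
      qed
    qed
    moreover have "\<not> p dvd ?m" using t unfolding D_def by auto
    then have "coprime p ?m" using p(1) by (simp add: prime_imp_coprime)
    ultimately have "squarefree (p * ?m)"
      using squarefree_mult_coprime[of p ?m] squarefree_prime[OF p(1)] by blast
    moreover have "q > B" if "prime q" "q dvd p * ?m" for q
      using that qB p by (metis prime_dvd_mult_iff primes_dvd_imp_eq)
    ultimately show ?thesis using rng[of t] t by auto
  qed
  have finG: "finite ?G" by (rule finite_subset[of _ "{..Y}"]) auto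
  have inj: "inj_on (\<lambda>t. p * (1 + M * t)) (I - ?bad)" using p0 M0 by (auto simp: inj_on_def)
  have "card (I - ?bad) \<le> card ?G"
    by (rule card_inj_on_le[OF inj _ finG]) (use good in blast)
  moreover have "card I \<le> card (I - ?bad) + card ?bad"
  proof -
    have "card I \<le> card ((I - ?bad) \<union> ?bad)" using finI by (intro card_mono) (auto simp: D_def)
    also have "\<dots> \<le> card (I - ?bad) + card ?bad" by (rule card_Un_le)
    finally show ?thesis .
  qed
  moreover have "card I = L" unfolding I_def by simp
  ultimately have 1: "real L \<le> real (card ?G) + real (card ?bad)" by linarith
  have Dle: "real (card (D m)) \<le> real L / real m + 1" if "coprime m M" "m > 0" for m
  proof -
    have "card (D m) \<le> L div m + 1"
      by (rule card_dvd_progression_le[OF that]) (auto simp: D_def I_def)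
    then have "real (card (D m)) \<le> real (L div m) + 1" by linarith
    then show ?thesis using of_nat_div_le_of_nat[of L m, where 'a = real] by linarith
  qed
  have "card ?bad \<le> card (D p) + card (\<Union>q\<in>{q\<in>{B<..s}. prime q}. D (q ^ 2))" by (rule card_Un_le)
  also have "card (\<Union>q\<in>{q\<in>{B<..s}. prime q}. D (q ^ 2)) \<le> (\<Sum>q\<in>{q\<in>{B<..s}. prime q}. card (D (q ^ 2)))"
    by (rule card_UN_le) simp
  finally have "real (card ?bad) \<le> real (card (D p)) + (\<Sum>q\<in>{q\<in>{B<..s}. prime q}. real (card (D (q ^ 2))))"
    by (simp flip: of_nat_sum of_nat_add)
  also have "(\<Sum>q\<in>{q\<in>{B<..s}. prime q}. real (card (D (q ^ 2)))) \<le>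
      (\<Sum>q\<in>{q\<in>{B<..s}. prime q}. real L * (1 / real q ^ 2) + 1)"
  proof (rule sum_mono)
    fix q assume "q \<in> {q\<in>{B<..s}. prime q}"
    then have q: "prime q" "q > B" by auto
    then show "real (card (D (q ^ 2))) \<le> real L * (1 / real q ^ 2) + 1"
      using Dle[of "q ^ 2"] copM[of q] by simp
  qed
  also have "\<dots> \<le> (\<Sum>q\<in>{B<..s}. real L * (1 / real q ^ 2) + 1)"
    by (rule sum_mono2) auto
  also have "\<dots> = real L * (\<Sum>q\<in>{B<..s}. 1 / real q ^ 2) + real (s - B)"
    by (simp add: sum.distrib sum_distrib_left)
  also have "\<dots> \<le> real L * (1 / real B) + sqrt (real Y)"
  proof (intro add_mono mult_left_mono)
    show "(\<Sum>q\<in>{B<..s}. 1 / real q ^ 2) \<le> 1 / real B" using B by (intro sum_inverse_squares_le) simp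
    have "real s \<le> sqrt (real Y)" unfolding s_def by simp
    then show "real (s - B) \<le> sqrt (real Y)" by linarith
  qed auto
  also have "real (card (D p)) \<le> real L / real p + 1" using Dle copM p p0 by blast
  finally have 2: "real (card ?bad) \<le> real L / real p + 1 + (real L * (1 / real B) + sqrt (real Y))" by simp
  have "real L / real p \<le> real L / 4" using p B p0 by (intro divide_left_mono) auto
  moreover have "real L * (1 / real B) \<le> real L * (1 / 4)"
    using B by (intro mult_left_mono divide_left_mono) auto
  ultimately have 3: "real (card ?G) \<ge> real L / 2 - 1 - sqrt (real Y)" using 1 2 by linarith
  have "real Y / (4 * real p * real M) \<le> real L + 1"
  proof -
    have "Y \<le> 4 * p * M * (L + 1)" unfolding L_def
      using dividend_less_times_div[of "4 * p * M" Y] p0 M0 by (simp add: algebra_simps)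
    then have "real Y \<le> real (4 * p * M * (L + 1))" by (simp only: of_nat_le_iff)
    then have "real Y \<le> (real L + 1) * (4 * real p * real M)" by (simp add: algebra_simps)
    then show ?thesis using p0 M0 by (simp add: pos_divide_le_eq)
  qed
  then have 4: "real L / 2 \<ge> real Y / (8 * real p * real M) - 1 / 2" by (simp add: field_simps)
  \<comment> \<open>The lower bound on sqrt Y makes the total error, at most 2 sqrt Y, no more than
    half of the main term Y/(8 p M).\<close>
  have "2 * sqrt (real Y) \<le> real Y / (16 * real p * real M)"
  proof -
    have "2 * sqrt (real Y) * (16 * real p * real M) = sqrt (real Y) * (32 * real p * real M)" by simp
    also have "\<dots> \<le> sqrt (real Y) * sqrt (real Y)" using Y by (intro mult_left_mono) auto
    also have "\<dots> = real Y" by simp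
    finally show ?thesis using p0 M0 by (simp add: pos_le_divide_eq)
  qed
  moreover have "real Y / (8 * real p * real M) = 2 * (real Y / (16 * real p * real M))" by simp
  ultimately show ?thesis using 3 4 sq1 by linarith
qed

section \<open>Pairs (n, p) with the root exchanged at p\<close>

context irreducible_monic_poly
begin

text \<open>Pigeonhole: the box holds (k+1)^d polynomials, more than the \<open>n\<close> possible
  residues of their values at \<open>r\<close>. The difference of two with equal residue is
  taken.\<close>

lemma thue:
  assumes n: "n > 0" "n \<le> k ^ d"
  obtains a where "a \<noteq> 0" "degree a < d" "\<And>i. \<bar>coeff a i\<bar> \<le> int k" "int n dvd poly a r"
proof -
  let ?f = "\<lambda>a. poly a r mod int n"
  have "?f ` box d (k + 1) \<subseteq> {0..<int n}" using n(1) by auto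
  then have "card (?f ` box d (k + 1)) \<le> n"
    using card_mono[of "{0..<int n}"] by fastforce
  also have "\<dots> < (k + 1) ^ d"
    using n(2) deg_pos power_strict_mono[of k "k + 1" d] by simp
  also have "\<dots> = card (box d (k + 1))" using box_card by simp
  finally have "\<not> inj_on ?f (box d (k + 1))" by (rule pigeonhole)
  then obtain b c where bc: "b \<in> box d (k + 1)" "c \<in> box d (k + 1)" "b \<noteq> c" "?f b = ?f c"
    unfolding inj_on_def by blast
  show ?thesis
  proof (rule that[of "b - c"])
    show "b - c \<noteq> 0" using bc by simp
    show "degree (b - c) < d" using bc box_degree deg_pos by (intro degree_diff_less) auto
    show "int n dvd poly (b - c) r" using bc(4) by (simp add: mod_eq_dvd_iff)
    fix i
    have "0 \<le> coeff b i" "coeff b i \<le> int k" "0 \<le> coeff c i" "coeff c i \<le> int k"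
      using bc(1,2) by (cases "i < d"; force simp: box_def)+
    then show "\<bar>coeff (b - c) i\<bar> \<le> int k" unfolding coeff_diff by linarith
  qed
qed

lemma card_ball:
  "finite {a. degree a < d \<and> (\<forall>i. \<bar>coeff a i\<bar> \<le> int k)}"
  "card {a. degree a < d \<and> (\<forall>i. \<bar>coeff a i\<bar> \<le> int k)} \<le> (2 * k + 1) ^ d"
proof -
  let ?A = "{a. degree a < d \<and> (\<forall>i. \<bar>coeff a i\<bar> \<le> int k)}"
  define c where "c = (\<Sum>i<d. monom (int k) i)"
  have cc: "coeff c i = (if i < d then int k else 0)" for i
    by (auto simp: c_def coeff_sum)
  have sub: "(\<lambda>a. a + c) ` ?A \<subseteq> box d (2 * k + 1)"
  proof
    fix b assume "b \<in> (\<lambda>a. a + c) ` ?A"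
    then obtain a where a: "degree a < d" "\<And>i. \<bar>coeff a i\<bar> \<le> int k" "b = a + c" by blast
    have "coeff a i + int k \<ge> 0 \<and> coeff a i + int k < int (2 * k + 1)" for i
      using a(2)[of i] by linarith
    then show "b \<in> box d (2 * k + 1)" using a(1)
      by (auto simp: box_def a(3) cc coeff_eq_0)
  qed
  have inj: "inj_on (\<lambda>a. a + c) ?A" by (auto simp: inj_on_def)
  have fin: "finite (box d (2 * k + 1))" using box_card by blast
  show "finite ?A" by (rule finite_imageD[OF finite_subset[OF sub fin] inj])
  show "card ?A \<le> (2 * k + 1) ^ d" using card_inj_on_le[OF inj sub fin] box_card by simp
qed

text \<open>With N(a) = n m, the map from (n, p) to (a, m) is injective. Clearly n = N(a)/m; if p
  and p' shared \<open>a\<close> and \<open>n\<close>, then \<open>a\<close> would vanish modulo p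
  at both roots, so p^2 would divide n m. As n is squarefree, p would divide m, which is nonzero and
  smaller than p in absolute value.\<close>

lemma card_twisted_pairs_le:
  obtains c :: real and B :: nat where "c > 0"
    "\<And>k R \<rho> \<rho>'. k > 0 \<Longrightarrow>
      (\<And>n p. (n, p) \<in> R \<Longrightarrow> squarefree n \<and> k ^ d < 2 * n \<and> n \<le> k ^ d \<and> prime p \<and> p dvd n \<and> p > B \<and>
        (\<forall>q. prime q \<longrightarrow> q dvd n \<longrightarrow> int q dvd poly P (\<rho> q)) \<and>
        int p dvd poly P (\<rho>' p) \<and> \<not> int p dvd \<rho> p - \<rho>' p) \<Longrightarrow>
      real (card R) \<le> c * real k ^ d"
proof -
  obtain C where C: "C > 0" "\<And>a k. degree a < d \<Longrightarrow> (\<And>i. \<bar>coeff a i\<bar> \<le> k) \<Longrightarrow> \<bar>pnorm P a\<bar> \<le> C * k ^ d"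
    using pnorm_bound by blast
  show ?thesis
  \<comment> \<open>There are at most (3 k)^d polynomials \<open>a\<close> and 4 C + 1 cofactors
    \<open>m\<close>. Since \<bar>m\<bar> \<le> 2 C, no p > 2 C divides a nonzero
    \<open>m\<close>.\<close>
  proof (rule that[of "3 ^ d * (4 * real_of_int C + 1)" "nat (2 * C)"])
    show "3 ^ d * (4 * real_of_int C + 1) > 0" using C(1) by simp
    fix k :: nat and R :: "(nat \<times> nat) set" and \<rho> \<rho>' :: "nat \<Rightarrow> int"
    assume k: "k > 0" and R: "\<And>n p. (n, p) \<in> R \<Longrightarrow> squarefree n \<and> k ^ d < 2 * n \<and> n \<le> k ^ d \<and>
        prime p \<and> p dvd n \<and> p > nat (2 * C) \<and>
        (\<forall>q. prime q \<longrightarrow> q dvd n \<longrightarrow> int q dvd poly P (\<rho> q)) \<and>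
        int p dvd poly P (\<rho>' p) \<and> \<not> int p dvd \<rho> p - \<rho>' p"
    let ?A = "{a. degree a < d \<and> (\<forall>i. \<bar>coeff a i\<bar> \<le> int k)}"
    let ?\<sigma> = "\<lambda>p q. if q = p then \<rho>' p else \<rho> q"
    have "\<exists>a m. a \<noteq> 0 \<and> a \<in> ?A \<and> pnorm P a = int (fst x) * m \<and> m \<in> {-2 * C..2 * C} \<and>
        (\<forall>q. prime q \<longrightarrow> q dvd fst x \<longrightarrow> int q dvd poly a (?\<sigma> (snd x) q))" if "x \<in> R" for x
    proof -
      obtain n p where x: "x = (n, p)" by (cases x)
      note r = R[OF that[unfolded x]]
      have n0: "n > 0" using r by (metis gr0I not_squarefree_0)
      obtain z where z: "\<And>q. q \<in> prime_factors n \<Longrightarrow> [z = ?\<sigma> p q] (mod int q)"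
        using crt_int[of "prime_factors n" "?\<sigma> p"] by (metis finite_set_mset in_prime_factors_imp_prime)
      have z': "[z = ?\<sigma> p q] (mod int q)" if "prime q" "q dvd n" for q
        using z that n0 by (simp add: prime_factors_dvd)
      have "int n dvd poly P z"
      proof (rule squarefree_dvd_int)
        show "squarefree n" using r by blast
        fix q assume q: "prime q" "q dvd n"
        have "int q dvd poly P (?\<sigma> p q)" using r q by auto
        then show "int q dvd poly P z" using poly_cong_int[OF z'[OF q]] by (metis cong_dvd_iff)
      qed
      then have gP: "dvd_mod (int n) [:- z, 1:] P" by (rule dvd_mod_linear)
      obtain a where a: "a \<noteq> 0" "degree a < d" "\<And>i. \<bar>coeff a i\<bar> \<le> int k" "int n dvd poly a z"
        using thue[OF n0] r by metis
      have "int n ^ degree [:- z, 1:] dvd pnorm P a"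
        by (rule pnorm_dvd_mod[OF _ _ dvd_mod_linear[OF a(4)] gP]) (use deg_pos in auto)
      then have "int n dvd pnorm P a" by simp
      then obtain m where m: "pnorm P a = int n * m" by (auto simp: dvd_def)
      have "int n * \<bar>m\<bar> = \<bar>pnorm P a\<bar>" using m by (simp add: abs_mult)
      also have "\<dots> \<le> C * int k ^ d" using C(2) a by blast
      \<comment> \<open>The restriction n > k^d / 2 turns the norm bound into a bound on
        \<open>m\<close>.\<close>
      also have "\<dots> \<le> C * int (2 * n)" using r C(1) by (intro mult_left_mono) (auto simp flip: of_nat_power)
      finally have "int n * \<bar>m\<bar> \<le> int n * (2 * C)" by (simp add: mult_ac)
      then have "\<bar>m\<bar> \<le> 2 * C" using n0 by simp
      then have "m \<in> {-2 * C..2 * C}" by auto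
      moreover have "int q dvd poly a (?\<sigma> p q)" if q: "prime q" "q dvd n" for q
      proof -
        have "int q dvd poly a z" using a(4) q(2) by (meson dvd_trans int_dvd_int_iff)
        then show ?thesis using poly_cong_int[OF z'[OF q]] by (metis cong_dvd_iff)
      qed
      ultimately show ?thesis using a m unfolding x fst_conv snd_conv
        by (intro exI[of _ a] exI[of _ m] conjI allI impI CollectI) blast+
    qed
    note ex = this
    define f where "f x = (SOME y. fst y \<noteq> 0 \<and> fst y \<in> ?A \<and> pnorm P (fst y) = int (fst x) * snd y \<and>
        snd y \<in> {-2 * C..2 * C} \<and>
        (\<forall>q. prime q \<longrightarrow> q dvd fst x \<longrightarrow> int q dvd poly (fst y) (?\<sigma> (snd x) q)))" for x
    define a m where "a x = fst (f x)" and "m x = snd (f x)" for x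
    have am: "a x \<noteq> 0 \<and> a x \<in> ?A \<and> pnorm P (a x) = int (fst x) * m x \<and>
        m x \<in> {-2 * C..2 * C} \<and>
        (\<forall>q. prime q \<longrightarrow> q dvd fst x \<longrightarrow> int q dvd poly (a x) (?\<sigma> (snd x) q))" if "x \<in> R" for x
      unfolding a_def m_def f_def
      by (rule someI_ex, unfold split_paired_Ex fst_conv snd_conv) (rule ex[OF that])
    have inj: "inj_on (\<lambda>x. (a x, m x)) R"
    proof (rule inj_onI)
      fix x y assume xy: "x \<in> R" "y \<in> R" "(a x, m x) = (a y, m y)"
      obtain n p where x: "x = (n, p)" by (cases x)
      obtain n' p' where y: "y = (n', p')" by (cases y)
      note ax = am[OF xy(1)] and ay = am[OF xy(2)]
      note r = R[OF xy(1)[unfolded x]]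
      have nz: "pnorm P (a x) \<noteq> 0" using ax pnorm_nonzero by blast
      have m0: "m x \<noteq> 0" using ax nz by auto
      have nn: "n = n'" using ax ay xy(3) m0 x y by auto
      have "p = p'"
      proof (rule ccontr)
        assume ne: "p \<noteq> p'"
        have p: "prime p" "p dvd n" "p > nat (2 * C)" using r by auto
        have pi: "prime (int p)" using p by simp
        have nx: "fst x = n" "snd x = p" "fst y = n'" "snd y = p'" using x y by auto
        have "\<forall>q. prime q \<longrightarrow> q dvd n \<longrightarrow> int q dvd poly (a x) (?\<sigma> p q)"
          using conjunct2[OF conjunct2[OF conjunct2[OF conjunct2[OF ax]]]] unfolding nx .
        then have "int p dvd poly (a x) (?\<sigma> p p)" using p by blast
        then have 1: "int p dvd poly (a x) (\<rho>' p)" by simp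
        have "\<forall>q. prime q \<longrightarrow> q dvd n \<longrightarrow> int q dvd poly (a y) (?\<sigma> p' q)"
          using conjunct2[OF conjunct2[OF conjunct2[OF conjunct2[OF ay]]]] unfolding nx nn .
        then have "int p dvd poly (a y) (?\<sigma> p' p)" using p by blast
        \<comment> \<open>The pair \<open>y\<close> exchanges the root at p' only, so at
          \<open>p\<close> its polynomial, which is also \<open>a x\<close>, vanishes at the
          original root.\<close>
        then have 2: "int p dvd poly (a x) (\<rho> p)" using ne xy(3) by simp
        let ?g = "[:- \<rho> p, 1:] * [:- \<rho>' p, 1:]"
        have nd: "\<not> int p dvd \<rho> p - \<rho>' p" using r by blast
        have g: "lead_coeff ?g = 1" "degree ?g = 2" by auto
        have gP: "dvd_mod (int p) ?g P" by (rule dvd_mod_two_roots[OF pi _ _ nd]) (use r in auto)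
        have ga: "dvd_mod (int p) ?g (a x)" by (rule dvd_mod_two_roots[OF pi 2 1 nd])
        have pu: "\<not> int p dvd 1" using p(1) by (simp add: prime_nat_iff)
        have "int p ^ degree ?g dvd pnorm P (a x)"
          by (rule pnorm_dvd_mod[OF g(1) dvd_mod_degree_le[OF pu g(1) gP] ga gP])
        then have "int p * int p dvd int n * m x" using ax x g(2) by (simp add: power2_eq_square)
        moreover obtain n1 where n1: "n = p * n1" using p by (auto simp: dvd_def)
        ultimately have "int p dvd int n1 * m x" using p(1) by (simp add: mult.assoc prime_gt_0_nat)
        moreover have "\<not> int p dvd int n1"
        proof
          assume "int p dvd int n1"
          then have "p ^ 2 dvd n" using n1 by (simp add: power2_eq_square)
          then have "is_unit p" using r by (meson squarefreeD)
          then show False using p(1) by simp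
        qed
        ultimately have "int p dvd m x" using pi by (metis prime_dvd_multD)
        then have "int p \<le> \<bar>m x\<bar>" using m0 dvd_imp_le_int[of "m x" "int p"] by simp
        moreover have "\<bar>m x\<bar> \<le> 2 * C" using ax by auto
        ultimately show False using p(3) by linarith
      qed
      then show "x = y" using nn x y by simp
    qed
    have fin: "finite (?A \<times> {-2 * C..2 * C})" using card_ball(1) by simp
    have "card R \<le> card (?A \<times> {-2 * C..2 * C})"
      by (rule card_inj_on_le[OF inj _ fin]) (use am in blast)
    also have "\<dots> = card ?A * nat (4 * C + 1)" by (simp add: card_cartesian_product)
    also have "\<dots> \<le> (2 * k + 1) ^ d * nat (4 * C + 1)" by (intro mult_right_mono card_ball(2)) auto
    also have "\<dots> \<le> (3 * k) ^ d * nat (4 * C + 1)" using k by (intro mult_right_mono power_mono) auto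
    finally have "real (card R) \<le> real ((3 * k) ^ d * nat (4 * C + 1))" by (simp only: of_nat_le_iff)
    also have "\<dots> = 3 ^ d * (4 * real_of_int C + 1) * real k ^ d"
      using C(1) by (simp add: power_mult_distrib)
    finally show "real (card R) \<le> 3 ^ d * (4 * real_of_int C + 1) * real k ^ d" .
  qed
qed

text \<open>Double counting: each p in \<open>F\<close> admits at least Y/(16 p M) numbers n, while
  all pairs (n, p) together number at most c Y.\<close>

theorem bounded_two_root_primes:
  assumes roots: "\<And>p. prime p \<Longrightarrow> p > B \<Longrightarrow> \<exists>x. int p dvd poly P x"
  shows "\<not> unbounded_reciprocals (two_root_primes P)"
proof
  assume unb: "unbounded_reciprocals (two_root_primes P)"
  obtain c B1 where c: "c > 0" and pairs: "\<And>k R \<rho> \<rho>'. k > 0 \<Longrightarrow>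
      (\<And>n p. (n, p) \<in> R \<Longrightarrow> squarefree n \<and> k ^ d < 2 * n \<and> n \<le> k ^ d \<and> prime p \<and> p dvd n \<and> p > B1 \<and>
        (\<forall>q. prime q \<longrightarrow> q dvd n \<longrightarrow> int q dvd poly P (\<rho> q)) \<and>
        int p dvd poly P (\<rho>' p) \<and> \<not> int p dvd \<rho> p - \<rho>' p) \<Longrightarrow>
      real (card R) \<le> c * real k ^ d"
    using card_twisted_pairs_le by blast
  \<comment> \<open>4 serves the squarefree sieve, \<open>B\<close> provides roots modulo all prime
    factors of n, and \<open>B1\<close> comes from the pair count.\<close>
  define B0 where "B0 = max 4 (max B B1)"
  define M :: nat where "M = fact B0"
  have M0: "M > 0" unfolding M_def by simp
  have "unbounded_reciprocals {p \<in> two_root_primes P. p > B0}"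
    by (rule unbounded_reciprocals_cofinite[OF unb, of B0]) simp
  then obtain F where F: "F \<subseteq> {p \<in> two_root_primes P. p > B0}" and finF: "finite F"
    and Fsum: "(\<Sum>p\<in>F. 1 / real p) > 16 * real M * c"
    unfolding unbounded_reciprocals_def by blast
  define \<rho> where "\<rho> q = (SOME x. int q dvd poly P x)" for q
  have \<rho>: "int q dvd poly P (\<rho> q)" if "prime q" "q > B0" for q
    unfolding \<rho>_def by (rule someI_ex, rule roots) (use that in \<open>auto simp: B0_def\<close>)
  define \<rho>' where "\<rho>' p = (SOME x. int p dvd poly P x \<and> \<not> int p dvd \<rho> p - x)" for p
  have Fp: "prime p" "p > B0" if "p \<in> F" for p
    using that F unfolding two_root_primes_def by auto
  have \<rho>': "int p dvd poly P (\<rho>' p) \<and> \<not> int p dvd \<rho> p - \<rho>' p" if pF: "p \<in> F" for p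
    unfolding \<rho>'_def
  proof (rule someI_ex)
    obtain x y where xy: "int p dvd poly P x" "int p dvd poly P y" "\<not> int p dvd x - y"
      using pF F unfolding two_root_primes_def by blast
    \<comment> \<open>The chosen root cannot be congruent to both \<open>x\<close> and
      \<open>y\<close>, so one of them can be the second root.\<close>
    have "\<not> (int p dvd \<rho> p - x \<and> int p dvd \<rho> p - y)"
    proof
      assume "int p dvd \<rho> p - x \<and> int p dvd \<rho> p - y"
      then have "int p dvd (\<rho> p - y) - (\<rho> p - x)" using dvd_diff by blast
      then show False using xy(3) by simp
    qed
    then show "\<exists>x. int p dvd poly P x \<and> \<not> int p dvd \<rho> p - x" using xy by blast
  qed
  \<comment> \<open>Makes sqrt Y at least 32 p M for all p in \<open>F\<close> at once.\<close>
  define k where "k = (\<Sum>p\<in>F. (32 * p * M) ^ 2) + 1"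
  define Y where "Y = k ^ d"
  have k0: "k > 0" unfolding k_def by simp
  define G where "G p = {n. squarefree n \<and> Y < 2 * n \<and> n \<le> Y \<and> p dvd n \<and> (\<forall>q. prime q \<longrightarrow> q dvd n \<longrightarrow> q > B0)}" for p
  have finG: "finite (G p)" for p unfolding G_def by (rule finite_subset[of _ "{..Y}"]) auto
  have Gge: "real (card (G p)) \<ge> real Y / (16 * real p * real M)" if "p \<in> F" for p
    unfolding G_def M_def
  proof (rule card_squarefree_ge)
    have "(32 * p * M) ^ 2 \<le> k"
      unfolding k_def using member_le_sum[of p F "\<lambda>p. (32 * p * M) ^ 2"] that finF by simp
    also have "\<dots> \<le> Y" unfolding Y_def using k0 deg_pos by (intro self_le_power) auto
    finally have "real ((32 * p * M) ^ 2) \<le> real Y" by (simp only: of_nat_le_iff)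
    then have "real (32 * p * M) \<le> sqrt (real Y)" by (simp only: of_nat_power real_le_rsqrt)
    then show "32 * real p * real (fact B0) \<le> sqrt (real Y)" unfolding M_def by simp
  qed (use Fp[OF that] in \<open>auto simp: B0_def\<close>)
  define R where "R = prod.swap ` (SIGMA p:F. G p)"
  have "card R = (\<Sum>p\<in>F. card (G p))"
    unfolding R_def using finF finG by (simp add: card_image)
  then have "real (card R) = (\<Sum>p\<in>F. real (card (G p)))" by simp
  also have "\<dots> \<ge> (\<Sum>p\<in>F. real Y / (16 * real M) * (1 / real p))"
  proof (rule sum_mono)
    fix p assume "p \<in> F"
    then show "real Y / (16 * real M) * (1 / real p) \<le> real (card (G p))"
      using Gge[of p] by (simp add: mult.assoc mult.commute[of "real M"])
  qed
  also have "(\<Sum>p\<in>F. real Y / (16 * real M) * (1 / real p)) = real Y / (16 * real M) * (\<Sum>p\<in>F. 1 / real p)"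
    by (rule sum_distrib_left[symmetric])
  finally have ge: "real (card R) \<ge> real Y / (16 * real M) * (\<Sum>p\<in>F. 1 / real p)" .
  have "real (card R) \<le> c * real k ^ d"
  proof (rule pairs[OF k0])
    fix n p assume "(n, p) \<in> R"
    then have np: "p \<in> F" "n \<in> G p" unfolding R_def by auto
    then show "squarefree n \<and> k ^ d < 2 * n \<and> n \<le> k ^ d \<and> prime p \<and> p dvd n \<and> p > B1 \<and>
        (\<forall>q. prime q \<longrightarrow> q dvd n \<longrightarrow> int q dvd poly P (\<rho> q)) \<and>
        int p dvd poly P (\<rho>' p) \<and> \<not> int p dvd \<rho> p - \<rho>' p"
      using \<rho>'[OF np(1)] \<rho> Fp[OF np(1)] unfolding G_def Y_def B0_def by auto
  qed
  then have "real Y / (16 * real M) * (\<Sum>p\<in>F. 1 / real p) \<le> c * real Y"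
    using ge unfolding Y_def by simp
  moreover have "real Y / (16 * real M) * (\<Sum>p\<in>F. 1 / real p) > real Y / (16 * real M) * (16 * real M * c)"
    using Fsum M0 k0 unfolding Y_def by (intro mult_strict_left_mono) auto
  moreover have "real Y / (16 * real M) * (16 * real M * c) = c * real Y" using M0 by simp
  ultimately show False by linarith
qed

end

section \<open>Primitive elements\<close>

abbreviation cev :: "int poly \<Rightarrow> complex \<Rightarrow> complex" where
  "cev U z \<equiv> poly (map_poly of_int U) z"

abbreviation rat_irreducible :: "int poly \<Rightarrow> bool" where
  "rat_irreducible P \<equiv> irreducible (map_poly (of_int :: int \<Rightarrow> rat) P)"

lemma cev_simps:
  "cev (U + V) z = cev U z + cev V z" "cev (U * V) z = cev U z * cev V z"
  "cev (smult c U) z = of_int c * cev U z" "cev [:c:] z = of_int c" "cev (U - V) z = cev U z - cev V z"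
  by (simp_all add: hom_distribs)

lemma clear_denominators:
  fixes u :: "rat poly"
  obtains N U where "N > 0" "map_poly (of_int :: int \<Rightarrow> rat) U = smult (of_int N) u"
proof -
  have "\<exists>N U. N > 0 \<and> map_poly (of_int :: int \<Rightarrow> rat) U = smult (of_int N) u"
  proof (induction u)
    case 0
    show ?case by (intro exI[of _ 1] exI[of _ 0]) auto
  next
    case (pCons a u)
    then obtain N U where NU: "N > 0" "map_poly (of_int :: int \<Rightarrow> rat) U = smult (of_int N) u" by blast
    obtain n m where nm: "quotient_of a = (n, m)" by fastforce
    then have m: "m > 0" "a = of_int n / of_int m"
      using quotient_of_denom_pos quotient_of_div by blast+
    have "map_poly (of_int :: int \<Rightarrow> rat) (pCons (N * n) (smult m U)) = smult (of_int (N * m)) (pCons a u)"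
      using m NU(2) by (simp add: hom_distribs mult.commute)
    moreover have "N * m > 0" using NU m by simp
    ultimately show ?case by blast
  qed
  then show ?thesis using that by blast
qed

text \<open>Otherwise \<open>Q\<close> and \<open>F\<close> are coprime over \<rat>, and a Bezout
  identity evaluated at \<theta> gives a nonzero integer equal to 0. Clearing denominators costs the
  factor \<open>N\<close>, harmless for primes not dividing it.\<close>

lemma cev_zero_imp_dvd:
  assumes Q: "rat_irreducible Q" "cev Q \<theta> = 0" and F: "cev F \<theta> = 0"
  obtains N W where "N > 0" "smult N F = Q * W"
proof -
  let ?r = "map_poly (of_int :: int \<Rightarrow> rat)"
  have "?r Q dvd ?r F"
  proof (rule ccontr)
    assume "\<not> ?r Q dvd ?r F"
    then have "coprime (?r Q) (?r F)"
      by (rule prime_elem_imp_coprime[OF field_poly_irreducible_imp_prime[OF Q(1)]])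
    then obtain s t where st: "s * ?r Q + t * ?r F = 1"
      by (metis bezout_coefficients_fst_snd coprime_imp_gcd_eq_1)
    obtain N1 S where S: "N1 > 0" "?r S = smult (of_int N1) s" using clear_denominators by blast
    obtain N2 T where T: "N2 > 0" "?r T = smult (of_int N2) t" using clear_denominators by blast
    have "?r (smult N2 S * Q + smult N1 T * F) = smult (of_int (N1 * N2)) (s * ?r Q + t * ?r F)"
      using S T by (simp add: hom_distribs smult_add_right mult.commute)
    also have "\<dots> = ?r [:N1 * N2:]" unfolding st by (simp add: hom_distribs)
    finally have "smult N2 S * Q + smult N1 T * F = [:N1 * N2:]"
      by (simp only: of_int_poly_hom.eq_iff)
    then have "cev (smult N2 S * Q + smult N1 T * F) \<theta> = cev [:N1 * N2:] \<theta>" by simp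
    then have "(of_int (N1 * N2) :: complex) = 0" unfolding cev_simps Q(2) F by simp
    then show False using S T by simp
  qed
  then obtain w where w: "?r F = ?r Q * w" by (auto simp: dvd_def)
  obtain N W where W: "N > 0" "?r W = smult (of_int N) w" using clear_denominators by blast
  have "?r (smult N F) = ?r (Q * W)" using w W by (simp add: hom_distribs)
  then have "smult N F = Q * W" by (simp only: of_int_poly_hom.eq_iff)
  then show ?thesis using that W by blast
qed

text \<open>Used twice: for inverses in \<rat>[\<theta>], and to see that \<open>F\<close> and
  \<open>Q\<close> have no common root modulo primes not dividing \<open>N\<close>.\<close>

lemma cev_nonzero_imp_bezout:
  assumes Q: "rat_irreducible Q" "cev Q \<theta> = 0" and F: "cev F \<theta> \<noteq> 0"
  obtains N S T where "N > 0" "F * S + Q * T = [:N:]"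
proof -
  let ?r = "map_poly (of_int :: int \<Rightarrow> rat)"
  have "\<not> ?r Q dvd ?r F"
  proof
    assume "?r Q dvd ?r F"
    then obtain w where w: "?r F = ?r Q * w" by (auto simp: dvd_def)
    obtain N W where W: "N > 0" "?r W = smult (of_int N) w" using clear_denominators by blast
    have "?r (smult N F) = ?r (Q * W)" using w W by (simp add: hom_distribs)
    then have "smult N F = Q * W" by (simp only: of_int_poly_hom.eq_iff)
    then have "cev (smult N F) \<theta> = cev (Q * W) \<theta>" by simp
    then show False using F Q(2) W(1) unfolding cev_simps by simp
  qed
  then have "coprime (?r Q) (?r F)"
    by (rule prime_elem_imp_coprime[OF field_poly_irreducible_imp_prime[OF Q(1)]])
  then obtain s t where st: "s * ?r Q + t * ?r F = 1"
    by (metis bezout_coefficients_fst_snd coprime_imp_gcd_eq_1)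
  obtain N1 S where S: "N1 > 0" "?r S = smult (of_int N1) s" using clear_denominators by blast
  obtain N2 T where T: "N2 > 0" "?r T = smult (of_int N2) t" using clear_denominators by blast
  have "?r (F * smult N1 T + Q * smult N2 S) = smult (of_int (N1 * N2)) (s * ?r Q + t * ?r F)"
    using S T by (simp add: hom_distribs smult_add_right mult.commute add.commute)
  also have "\<dots> = ?r [:N1 * N2:]" unfolding st by (simp add: hom_distribs)
  finally have "F * smult N1 T + Q * smult N2 S = [:N1 * N2:]"
    by (simp only: of_int_poly_hom.eq_iff)
  then show ?thesis by (rule that[OF mult_pos_pos[OF S(1) T(1)]])
qed

text \<open>All powers of \<alpha> + k \<beta> lie in the \<rat>-span of the products \<alpha>^i
  \<beta>^j with i, j < d, where d = degree P; hence d^2 + 1 of them are dependent.\<close>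

lemma algebraic_combination:
  assumes P: "degree P > 0" and \<alpha>: "cev P \<alpha> = 0" and \<beta>: "cev P \<beta> = 0"
  obtains F where "F \<noteq> 0" "cev F (\<alpha> + of_nat k * \<beta>) = 0"
proof -
  let ?d = "degree P"
  define \<theta> where "\<theta> = \<alpha> + of_nat k * \<beta>"
  interpret V: Vector_Spaces.vector_space "\<lambda>(q::rat) (z::complex). of_rat q * z"
    by unfold_locales (auto simp: algebra_simps of_rat_add of_rat_mult)
  interpret R: map_poly_comm_ring_hom "of_rat :: rat \<Rightarrow> complex" ..
  define S where "S = (\<lambda>(i, j). \<alpha> ^ i * \<beta> ^ j) ` ({..<?d} \<times> {..<?d})"
  have finS: "finite S" unfolding S_def by simp
  have cardS: "card S \<le> ?d * ?d"
    unfolding S_def using card_image_le[of "{..<?d} \<times> {..<?d}" "\<lambda>(i, j). \<alpha> ^ i * \<beta> ^ j"] by simp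
  \<comment> \<open>The spectator factor \<open>y\<close> lets the reduction by P(z) = 0 be applied
    to the powers of \<alpha> and then to those of \<beta>.\<close>
  have red: "z ^ i * y \<in> V.span S"
    if z: "cev P z = 0" and y: "\<And>k. k < ?d \<Longrightarrow> z ^ k * y \<in> V.span S" for z y i
  proof (induction i rule: less_induct)
    case (less i)
    show ?case
    proof (cases "i < ?d")
      case True
      then show ?thesis by (rule y)
    next
      case False
      define c where "c = lead_coeff P"
      have c0: "c \<noteq> 0" unfolding c_def using P by auto
      have "0 = (\<Sum>k\<le>?d. of_int (coeff P k) * z ^ k)"
        using z by (simp add: poly_altdef)
      also have "\<dots> = (\<Sum>k<?d. of_int (coeff P k) * z ^ k) + of_int c * z ^ ?d"
        unfolding c_def by (simp add: lessThan_Suc_atMost[symmetric])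
      finally have "of_int c * z ^ ?d = - (\<Sum>k<?d. of_int (coeff P k) * z ^ k)"
        by (simp add: eq_neg_iff_add_eq_0 add.commute)
      then have zd: "z ^ ?d = - (\<Sum>k<?d. of_int (coeff P k) * z ^ k) / of_int c"
        using c0 by (simp add: field_simps)
      have "z ^ i = z ^ (i - ?d) * z ^ ?d" using False by (simp flip: power_add)
      also have "\<dots> = (\<Sum>k<?d. of_rat (- (of_int (coeff P k)) / of_int c) * z ^ (i - ?d + k))"
        unfolding zd by (simp add: sum_distrib_left sum_divide_distrib sum_negf[symmetric] power_add of_rat_divide of_rat_minus mult_ac)
      finally have "z ^ i * y = (\<Sum>k<?d. of_rat (- (of_int (coeff P k)) / of_int c) * (z ^ (i - ?d + k) * y))"
        by (simp add: sum_distrib_right mult.assoc)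
      also have "\<dots> \<in> V.span S"
        by (intro V.span_sum V.span_scale less.IH) (use False in auto)
      finally show ?thesis .
    qed
  qed
  have a1: "\<alpha> ^ i * \<beta> ^ j \<in> V.span S" if "j < ?d" for i j
    by (rule red[OF \<alpha>]) (use that in \<open>auto simp: S_def intro!: V.span_base\<close>)
  have "\<beta> ^ j * \<alpha> ^ i \<in> V.span S" for i j
  proof (rule red[OF \<beta>])
    fix k assume "k < ?d"
    then show "\<beta> ^ k * \<alpha> ^ i \<in> V.span S" using a1[of k i] by (simp only: mult.commute)
  qed
  then have ab: "\<alpha> ^ i * \<beta> ^ j \<in> V.span S" for i j by (simp add: mult.commute)
  have pw: "\<theta> ^ n \<in> V.span S" for n
  proof -
    have "\<theta> ^ n = (\<Sum>m\<le>n. of_rat (of_nat (n choose m) * of_nat k ^ (n - m)) * (\<alpha> ^ m * \<beta> ^ (n - m)))"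
      unfolding \<theta>_def binomial_ring by (simp add: power_mult_distrib of_rat_mult of_rat_power mult_ac)
    also have "\<dots> \<in> V.span S" by (intro V.span_sum V.span_scale ab)
    finally show ?thesis .
  qed
  let ?n = "?d * ?d"
  have "\<exists>f :: rat poly. f \<noteq> 0 \<and> poly (map_poly of_rat f) \<theta> = 0"
  proof (cases "inj_on (\<lambda>n. \<theta> ^ n) {..?n}")
    case False
    \<comment> \<open>If two powers coincide, the set of powers is too small for the dimension
      bound, but x^i - x^j vanishes at \<theta>.\<close>
    then obtain i j where ij: "\<theta> ^ i = \<theta> ^ j" "i \<noteq> j" by (auto simp: inj_on_def)
    have "monom 1 i - monom (1 :: rat) j \<noteq> 0" using ij(2)
      by (metis degree_monom_eq eq_iff_diff_eq_0 zero_neq_one)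
    moreover have "poly (map_poly of_rat (monom 1 i - monom (1 :: rat) j)) \<theta> = 0"
      using ij(1) by (simp add: hom_distribs poly_monom)
    ultimately show ?thesis by blast
  next
    case True
    let ?T = "(\<lambda>n. \<theta> ^ n) ` {..?n}"
    have "card ?T = Suc ?n" using True by (simp add: card_image)
    then have "V.dependent ?T"
      using V.independent_span_bound[OF finS, of ?T] pw cardS by fastforce
    then obtain u where u: "\<exists>v\<in>?T. u v \<noteq> 0" "(\<Sum>v\<in>?T. of_rat (u v) * v) = 0"
      using V.dependent_finite[of ?T] by auto
    define f where "f = (\<Sum>n\<le>?n. monom (u (\<theta> ^ n)) n)"
    have "coeff f n = u (\<theta> ^ n)" if "n \<le> ?n" for n
      using that by (simp add: f_def coeff_sum)
    then have f0: "f \<noteq> 0" using u(1) by (metis (no_types, lifting) atMost_iff coeff_0 imageE)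
    have "poly (map_poly of_rat f) \<theta> = (\<Sum>n\<le>?n. of_rat (u (\<theta> ^ n)) * \<theta> ^ n)"
      unfolding f_def by (simp add: hom_distribs poly_sum poly_monom)
    also have "\<dots> = (\<Sum>v\<in>?T. of_rat (u v) * v)"
      using True by (simp add: sum.reindex)
    finally have "poly (map_poly of_rat f) \<theta> = 0" using u(2) by simp
    then show ?thesis using f0 by blast
  qed
  then obtain f :: "rat poly" where f: "f \<noteq> 0" "poly (map_poly of_rat f) \<theta> = 0" by blast
  obtain N F where F: "N > 0" "map_poly (of_int :: int \<Rightarrow> rat) F = smult (of_int N) f"
    using clear_denominators by blast
  have "F \<noteq> 0" using F f(1) by auto
  moreover have "cev F \<theta> = 0"
  proof -
    have "map_poly of_int F = map_poly (of_rat :: rat \<Rightarrow> complex) (map_poly of_int F)"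
      by (simp add: map_poly_map_poly o_def)
    also have "\<dots> = smult (of_int N) (map_poly of_rat f)" unfolding F(2) by (simp add: hom_distribs)
    finally show ?thesis using f(2) by simp
  qed
  ultimately show ?thesis using that unfolding \<theta>_def by blast
qed

text \<open>Take least degree: a proper factor over \<rat>, with denominators cleared, would vanish
  at \<theta> in smaller degree.\<close>

lemma minimal_int_poly:
  assumes "F \<noteq> 0" "cev F \<theta> = 0"
  obtains Q where "rat_irreducible Q" "cev Q \<theta> = 0" "degree Q > 0"
proof -
  let ?r = "map_poly (of_int :: int \<Rightarrow> rat)"
  define n where "n = (LEAST n. \<exists>Q. Q \<noteq> 0 \<and> cev Q \<theta> = 0 \<and> degree Q = n)"
  have ex: "\<exists>n Q. Q \<noteq> 0 \<and> cev Q \<theta> = 0 \<and> degree Q = n" using assms by blast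
  obtain Q where Q: "Q \<noteq> 0" "cev Q \<theta> = 0" "degree Q = n"
    using LeastI_ex[OF ex] unfolding n_def by blast
  have least: "n \<le> degree U" if "U \<noteq> 0" "cev U \<theta> = 0" for U
    unfolding n_def by (rule Least_le) (use that in blast)
  have n0: "n > 0"
  proof (rule ccontr)
    assume "\<not> n > 0"
    then obtain c where "Q = [:c:]" using Q(3) by (metis degree_eq_zeroE gr0I)
    then show False using Q(1,2) by (simp add: cev_simps)
  qed
  have "irreducible (?r Q)"
  proof (rule irreducibleI)
    show "?r Q \<noteq> 0" using Q(1) by simp
    show "\<not> is_unit (?r Q)" using n0 Q(3) by (auto simp: is_unit_iff_degree Q(1))
    fix a b assume ab: "?r Q = a * b"
    have ab0: "a \<noteq> 0" "b \<noteq> 0" using ab Q(1) by auto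
    have dab: "degree a + degree b = n"
      using arg_cong[OF ab, of degree] degree_mult_eq[OF ab0] Q(3) by simp
    obtain N1 A where A: "N1 > 0" "?r A = smult (of_int N1) a" using clear_denominators by blast
    obtain N2 B where B: "N2 > 0" "?r B = smult (of_int N2) b" using clear_denominators by blast
    have "?r (A * B) = ?r (smult (N1 * N2) Q)" using A B ab by (simp add: hom_distribs mult.commute)
    then have "A * B = smult (N1 * N2) Q" by (simp only: of_int_poly_hom.eq_iff)
    then have "cev (A * B) \<theta> = cev (smult (N1 * N2) Q) \<theta>" by simp
    then have "cev A \<theta> = 0 \<or> cev B \<theta> = 0" unfolding cev_simps Q(2) by simp
    moreover have "A \<noteq> 0" "B \<noteq> 0" using A B ab0 by auto
    moreover have "degree A = degree a" "degree B = degree b"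
      using arg_cong[OF A(2), of degree] arg_cong[OF B(2), of degree] A(1) B(1) by simp_all
    ultimately have "degree a \<ge> n \<or> degree b \<ge> n" using least by metis
    then have "degree b = 0 \<or> degree a = 0" using dab by linarith
    then show "is_unit a \<or> is_unit b" using ab0 by (auto simp: is_unit_iff_degree)
  qed
  then show ?thesis using that Q n0 by blast
qed

text \<open>The ring \<open>\<rat>[\<theta>]\<close>, described by integer polynomials and a common denominator.\<close>
definition rat_span :: "complex \<Rightarrow> complex set" where
  "rat_span \<theta> = {z. \<exists>N U. N > 0 \<and> of_int N * z = cev U \<theta>}"

lemma rat_spanI: "N > 0 \<Longrightarrow> of_int N * z = cev U \<theta> \<Longrightarrow> z \<in> rat_span \<theta>"
  unfolding rat_span_def by blast

lemma rat_span_int: "of_int c \<in> rat_span \<theta>"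
  by (rule rat_spanI[of 1 _ "[:c:]"]) (auto simp: cev_simps)

lemma rat_span_gen: "\<theta> \<in> rat_span \<theta>"
  by (rule rat_spanI[of 1 _ "[:0, 1:]"]) (auto simp: hom_distribs)

lemma rat_span_mult:
  assumes "x \<in> rat_span \<theta>" "y \<in> rat_span \<theta>"
  shows "x * y \<in> rat_span \<theta>"
proof -
  obtain N U where N: "N > 0" "of_int N * x = cev U \<theta>" using assms unfolding rat_span_def by blast
  obtain M V where M: "M > 0" "of_int M * y = cev V \<theta>" using assms unfolding rat_span_def by blast
  show ?thesis
  proof (rule rat_spanI[of "N * M" _ "U * V"])
    show "of_int (N * M) * (x * y) = cev (U * V) \<theta>"
      unfolding cev_simps N(2)[symmetric] M(2)[symmetric] by (simp add: mult_ac)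
  qed (use N M in simp)
qed

lemma rat_span_add:
  assumes "x \<in> rat_span \<theta>" "y \<in> rat_span \<theta>"
  shows "x + y \<in> rat_span \<theta>"
proof -
  obtain N U where N: "N > 0" "of_int N * x = cev U \<theta>" using assms unfolding rat_span_def by blast
  obtain M V where M: "M > 0" "of_int M * y = cev V \<theta>" using assms unfolding rat_span_def by blast
  show ?thesis
  proof (rule rat_spanI[of "N * M" _ "smult M U + smult N V"])
    show "of_int (N * M) * (x + y) = cev (smult M U + smult N V) \<theta>"
      unfolding cev_simps N(2)[symmetric] M(2)[symmetric] by (simp add: algebra_simps)
  qed (use N M in simp)
qed

lemma rat_span_uminus: "x \<in> rat_span \<theta> \<Longrightarrow> - x \<in> rat_span \<theta>"
  using rat_span_mult[of "of_int (-1)" \<theta> x] rat_span_int[of "-1" \<theta>] by simp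

lemma rat_span_0: "0 \<in> rat_span \<theta>"
  using rat_span_int[of 0 \<theta>] by simp

lemma rat_span_sum: "(\<And>i. i \<in> A \<Longrightarrow> f i \<in> rat_span \<theta>) \<Longrightarrow> sum f A \<in> rat_span \<theta>"
  by (induction A rule: infinite_finite_induct) (auto intro: rat_span_add rat_span_0)

text \<open>A Bezout identity with \<open>Q\<close> inverts U(\<theta>); thus \<rat>[\<theta>] is a
  field.\<close>

lemma rat_span_inverse:
  assumes Q: "rat_irreducible Q" "cev Q \<theta> = 0" and x: "x \<in> rat_span \<theta>" "x \<noteq> 0"
  shows "inverse x \<in> rat_span \<theta>"
proof -
  obtain N U where N: "N > 0" "of_int N * x = cev U \<theta>" using x unfolding rat_span_def by blast
  then have "cev U \<theta> \<noteq> 0" using x(2) by (metis less_irrefl mult_eq_0_iff of_int_eq_0_iff)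
  then obtain M S T where M: "M > 0" "U * S + Q * T = [:M:]"
    using cev_nonzero_imp_bezout[OF Q] by blast
  have "cev (U * S + Q * T) \<theta> = cev [:M:] \<theta>" using M(2) by simp
  then have "of_int N * x * cev S \<theta> = of_int M" unfolding cev_simps Q(2) N(2) by simp
  then have "of_int M * inverse x = cev (smult N S) \<theta>"
    unfolding cev_simps using x(2) by (simp add: field_simps)
  then show ?thesis using M(1) by (rule rat_spanI[rotated])
qed

section \<open>Polynomials over the field \<rat>[\<theta>]\<close>

definition poly_over :: "complex set \<Rightarrow> complex poly set" where
  "poly_over K = {f. \<forall>i. coeff f i \<in> K}"

lemma poly_over_add: "f \<in> poly_over (rat_span \<theta>) \<Longrightarrow> g \<in> poly_over (rat_span \<theta>) \<Longrightarrow> f + g \<in> poly_over (rat_span \<theta>)"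
  unfolding poly_over_def by (auto intro: rat_span_add)

lemma poly_over_mult: "f \<in> poly_over (rat_span \<theta>) \<Longrightarrow> g \<in> poly_over (rat_span \<theta>) \<Longrightarrow> f * g \<in> poly_over (rat_span \<theta>)"
  unfolding poly_over_def by (auto simp: coeff_mult intro!: rat_span_sum rat_span_mult)

lemma poly_over_pCons: "c \<in> rat_span \<theta> \<Longrightarrow> f \<in> poly_over (rat_span \<theta>) \<Longrightarrow> pCons c f \<in> poly_over (rat_span \<theta>)"
  unfolding poly_over_def by (auto simp: coeff_pCons split: nat.splits)

lemma poly_over_0: "0 \<in> poly_over (rat_span \<theta>)"
  unfolding poly_over_def by (simp add: rat_span_0)

lemma poly_over_monom: "c \<in> rat_span \<theta> \<Longrightarrow> monom c n \<in> poly_over (rat_span \<theta>)"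
  unfolding poly_over_def by (simp add: rat_span_0)

lemma poly_over_pcompose:
  assumes "f \<in> poly_over (rat_span \<theta>)" "g \<in> poly_over (rat_span \<theta>)"
  shows "pcompose f g \<in> poly_over (rat_span \<theta>)"
  using assms(1)
proof (induction f)
  case (pCons a f)
  have "a \<in> rat_span \<theta>" using pCons.prems unfolding poly_over_def by (auto dest: spec[of _ 0])
  moreover have "f \<in> poly_over (rat_span \<theta>)"
    using pCons.prems unfolding poly_over_def by (auto dest: spec[of _ "Suc _"])
  ultimately show ?case
    unfolding pcompose_pCons
    by (intro poly_over_add poly_over_mult assms(2) pCons.IH poly_over_pCons poly_over_0)
qed (simp add: poly_over_0)

text \<open>A double root is a root of the derivative, which is nonzero, of smaller degree, and
  would be a multiple of \<open>P\<close> up to a constant.\<close>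

lemma irreducible_root_simple:
  assumes P: "rat_irreducible P" and z: "cev P z = 0" and d: "degree P > 0"
  shows "\<not> [:- z, 1:] ^ 2 dvd map_poly of_int P"
proof
  assume "[:- z, 1:] ^ 2 dvd map_poly of_int P"
  then obtain h where h: "map_poly of_int P = [:- z, 1:] ^ 2 * h" by (auto simp: dvd_def)
  define l where "l = [:- z, 1:]"
  have lz: "poly l z = 0" by (simp add: l_def)
  have "map_poly of_int (pderiv P) = pderiv (map_poly (of_int :: int \<Rightarrow> complex) P)"
    by (simp add: of_int_hom.map_poly_pderiv)
  also have "\<dots> = l * pderiv (l * h) + l * h * pderiv l"
    unfolding h l_def[symmetric] power2_eq_square mult.assoc by (subst pderiv_mult) (simp add: mult.assoc)
  finally have "cev (pderiv P) z = 0" using lz by simp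
  then obtain N W where NW: "N > 0" "smult N (pderiv P) = P * W"
    using cev_zero_imp_dvd[OF P z] by blast
  have "pderiv P \<noteq> 0" using d by (simp add: pderiv_eq_0_iff)
  then have "W \<noteq> 0" using NW by auto
  then have "degree (P * W) \<ge> degree P" using d by (subst degree_mult_eq) auto
  moreover have "degree (smult N (pderiv P)) = degree P - 1" using NW(1) by (simp add: degree_pderiv)
  ultimately show False using NW(2) d by simp
qed

text \<open>\<open>G\<close> is a minimal polynomial of \<beta> over \<rat>[\<theta>] and divides
  both P(x) and P(\<theta> - k x). For suitable k their only common root is \<beta>, which is simple
  in P; so \<open>G\<close> is linear and \<beta> lies in \<rat>[\<theta>].\<close>

theorem primitive_element:
  assumes P: "rat_irreducible P" and d: "degree P \<ge> 2"
  obtains Q \<theta> \<alpha> \<beta> where "rat_irreducible Q" "degree Q > 0" "cev Q \<theta> = 0"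
    "cev P \<alpha> = 0" "cev P \<beta> = 0" "\<alpha> \<noteq> \<beta>" "\<alpha> \<in> rat_span \<theta>" "\<beta> \<in> rat_span \<theta>"
proof -
  let ?P = "map_poly of_int P :: complex poly"
  have d0: "degree P > 0" using d by simp
  have P0: "?P \<noteq> 0" using d by auto
  have fta: "\<exists>z. poly f z = 0" if "degree f > 0" for f :: "complex poly"
    by (rule fundamental_theorem_of_algebra_alt) (use that in auto)
  obtain \<alpha> where \<alpha>: "poly ?P \<alpha> = 0" using fta[of ?P] d by auto
  obtain S where S: "?P = [:- \<alpha>, 1:] * S" using \<alpha> by (auto simp: poly_eq_0_iff_dvd dvd_def)
  have "S \<noteq> 0" using S P0 by auto
  then have "degree ?P = 1 + degree S" unfolding S by (subst degree_mult_eq) auto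
  then have "degree S > 0" using d by simp
  then obtain \<beta> where \<beta>S: "poly S \<beta> = 0" using fta by blast
  have \<beta>: "poly ?P \<beta> = 0" unfolding S using \<beta>S by simp
  have ne: "\<alpha> \<noteq> \<beta>"
  proof
    assume "\<alpha> = \<beta>"
    then have "[:- \<alpha>, 1:] dvd S" using \<beta>S by (simp add: poly_eq_0_iff_dvd)
    then have "[:- \<alpha>, 1:] ^ 2 dvd ?P" unfolding S power2_eq_square by (rule mult_dvd_mono[OF dvd_refl])
    then show False using irreducible_root_simple[OF P \<alpha> d0] by blast
  qed
  let ?Z = "{z. poly ?P z = 0}"
  have finZ: "finite ?Z" by (rule poly_roots_finite[OF P0])
  \<comment> \<open>The k for which \<theta> - k g is a root a of \<open>P\<close> for some root g
    \<noteq> \<beta>; these would be further common roots.\<close>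
  define Bad where "Bad = (\<lambda>(a, g). (a - \<alpha>) / (\<beta> - g)) ` (?Z \<times> ?Z)"
  have "finite Bad" unfolding Bad_def using finZ by simp
  moreover have "infinite (range (of_nat :: nat \<Rightarrow> complex))"
    by (rule range_inj_infinite) (simp add: inj_of_nat)
  ultimately obtain k :: nat where k: "of_nat k \<notin> Bad"
    by (metis finite_subset image_subset_iff)
  define \<theta> where "\<theta> = \<alpha> + of_nat k * \<beta>"
  obtain F where F: "F \<noteq> 0" "cev F \<theta> = 0"
    using algebraic_combination[OF d0 \<alpha> \<beta>, of k] unfolding \<theta>_def by blast
  obtain Q where Q: "rat_irreducible Q" "cev Q \<theta> = 0" "degree Q > 0"
    using minimal_int_poly[OF F] by blast
  let ?K = "rat_span \<theta>"
  have PK: "?P \<in> poly_over ?K" unfolding poly_over_def by (simp add: rat_span_int)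
  define n where "n = (LEAST n. \<exists>G. G \<in> poly_over ?K \<and> G \<noteq> 0 \<and> poly G \<beta> = 0 \<and> degree G = n)"
  have ex: "\<exists>n G. G \<in> poly_over ?K \<and> G \<noteq> 0 \<and> poly G \<beta> = 0 \<and> degree G = n" using PK P0 \<beta> by blast
  obtain G where G: "G \<in> poly_over ?K" "G \<noteq> 0" "poly G \<beta> = 0" "degree G = n"
    using LeastI_ex[OF ex] unfolding n_def by blast
  have least: "n \<le> degree f" if "f \<in> poly_over ?K" "f \<noteq> 0" "poly f \<beta> = 0" for f
    unfolding n_def by (rule Least_le) (use that in blast)
  \<comment> \<open>Division with remainder by \<open>G\<close>, possible because its leading
    coefficient is invertible in \<rat>[\<theta>].\<close>
  have Gdvd: "G dvd f" if "f \<in> poly_over ?K" "poly f \<beta> = 0" for f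
    using that
  proof (induction "degree f" arbitrary: f rule: less_induct)
    case less
    show ?case
    proof (cases "f = 0")
      case False
      have ge: "degree G \<le> degree f" using least less.prems False G(4) by blast
      define c where "c = lead_coeff f * inverse (lead_coeff G)"
      have cK: "c \<in> ?K"
        unfolding c_def using less.prems G(1,2)
        by (intro rat_span_mult rat_span_inverse[OF Q(1,2)]) (auto simp: poly_over_def)
      define h where "h = f + monom (- c) (degree f - degree G) * G"
      have hK: "h \<in> poly_over ?K" unfolding h_def
        by (intro poly_over_add poly_over_mult poly_over_monom rat_span_uminus cK less.prems G(1))
      have h\<beta>: "poly h \<beta> = 0" unfolding h_def using less.prems G(3) by simp
      have "degree h \<le> degree f" unfolding h_def
        using ge degree_mult_le[of "monom (- c) (degree f - degree G)" G] degree_monom_le[of "- c" "degree f - degree G"]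
        by (intro degree_add_le) auto
      moreover have "coeff h (degree f) = 0"
        unfolding h_def coeff_add coeff_monom_mult using ge G(2) by (simp add: c_def)
      ultimately have hd: "h = 0 \<or> degree h < degree f"
        by (metis leading_coeff_0_iff le_neq_implies_less)
      have "G dvd h"
      proof (cases "h = 0")
        case False
        then show ?thesis using hd less.hyps[of h] hK h\<beta> by blast
      qed simp
      then have "G dvd h - monom (- c) (degree f - degree G) * G" by (intro dvd_diff) auto
      then show ?thesis unfolding h_def by simp
    qed simp
  qed
  have "n > 0"
  proof (rule ccontr)
    assume "\<not> n > 0"
    then obtain g where "G = [:g:]" using G(4) by (metis degree_eq_zeroE gr0I)
    then show False using G(2,3) by simp
  qed
  have "\<not> n \<ge> 2"
  proof
    assume n2: "n \<ge> 2"
    obtain G' where G': "G = [:- \<beta>, 1:] * G'" using G(3) by (auto simp: poly_eq_0_iff_dvd dvd_def)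
    have "G' \<noteq> 0" using G' G(2) by auto
    then have "degree G = 1 + degree G'" unfolding G' by (subst degree_mult_eq) auto
    then have "degree G' > 0" using n2 G(4) by simp
    then obtain \<gamma> where \<gamma>: "poly G' \<gamma> = 0" using fta by blast
    have GP: "G dvd ?P" using Gdvd PK \<beta> by blast
    \<comment> \<open>At x = \<beta> the polynomial P(\<theta> - k x) takes the value P(\<alpha>) =
      0.\<close>
    have "G dvd pcompose ?P [:\<theta>, - of_nat k:]"
    proof (rule Gdvd)
      show "pcompose ?P [:\<theta>, - of_nat k:] \<in> poly_over ?K"
        using rat_span_uminus[OF rat_span_int[of "int k" \<theta>]]
        by (intro poly_over_pcompose PK poly_over_pCons poly_over_0 rat_span_gen) simp
      show "poly (pcompose ?P [:\<theta>, - of_nat k:]) \<beta> = 0"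
        using \<alpha> by (simp add: poly_pcompose \<theta>_def mult.commute)
    qed
    moreover have "poly G \<gamma> = 0" unfolding G' using \<gamma> by simp
    ultimately have "poly (pcompose ?P [:\<theta>, - of_nat k:]) \<gamma> = 0" "poly ?P \<gamma> = 0"
      using GP by (metis dvdE mult_zero_left poly_mult)+
    then have z: "poly ?P (\<theta> - of_nat k * \<gamma>) = 0" "poly ?P \<gamma> = 0"
      by (auto simp: poly_pcompose mult.commute)
    show False
    proof (cases "\<gamma> = \<beta>")
      case True
      then have "[:- \<beta>, 1:] dvd G'" using \<gamma> by (simp add: poly_eq_0_iff_dvd)
      then have "[:- \<beta>, 1:] ^ 2 dvd G" unfolding G' power2_eq_square by (rule mult_dvd_mono[OF dvd_refl])
      then show False using irreducible_root_simple[OF P \<beta> d0] GP by (meson dvd_trans)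
    next
      case False
      have "of_nat k = ((\<theta> - of_nat k * \<gamma>) - \<alpha>) / (\<beta> - \<gamma>)"
        using False by (simp add: \<theta>_def field_simps)
      then have "of_nat k \<in> Bad" unfolding Bad_def using z by force
      then show False using k by blast
    qed
  qed
  then have "n = 1" using \<open>n > 0\<close> by simp
  then obtain g0 g1 where g: "G = [:g0, g1:]" "g1 \<noteq> 0" using G(4) degree1_coeffs[of G] by metis
  have gK: "g0 \<in> ?K" "g1 \<in> ?K" using G(1) unfolding g poly_over_def
    by (auto dest: spec[of _ 0] spec[of _ "Suc 0"])
  have "\<beta> = (- g0) * inverse g1" using G(3) g by (simp add: field_simps eq_neg_iff_add_eq_0)
  then have \<beta>K: "\<beta> \<in> ?K"
    using gK g(2) by (auto intro!: rat_span_mult rat_span_uminus rat_span_inverse[OF Q(1,2)])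
  have "\<alpha> = \<theta> + (- (of_int (int k) * \<beta>))" unfolding \<theta>_def by simp
  then have \<alpha>K: "\<alpha> \<in> ?K"
    by (metis rat_span_add rat_span_gen rat_span_uminus rat_span_mult rat_span_int \<beta>K)
  show ?thesis by (rule that[OF Q(1,3,2) \<alpha> \<beta> ne \<alpha>K \<beta>K])
qed

section \<open>A prime without roots\<close>

text \<open>This is c^(degree P) P(x/c); for nonzero c its roots are c times those of
  \<open>P\<close>.\<close>

definition dilate :: "int \<Rightarrow> int poly \<Rightarrow> int poly" where
  "dilate c P = (\<Sum>i\<le>degree P. monom (coeff P i * c ^ (degree P - i)) i)"

lemma poly_dilate:
  fixes x :: "'a :: {idom, ring_char_0}"
  shows "poly (map_poly of_int (dilate c P)) (of_int c * x) = of_int c ^ degree P * poly (map_poly of_int P) x"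
proof -
  have "poly (map_poly of_int (dilate c P)) (of_int c * x) =
      (\<Sum>i\<le>degree P. of_int (coeff P i) * (of_int c ^ (degree P - i) * of_int c ^ i) * x ^ i)"
    unfolding dilate_def by (simp add: hom_distribs poly_sum poly_monom power_mult_distrib mult_ac)
  also have "\<dots> = (\<Sum>i\<le>degree P. of_int c ^ degree P * (of_int (coeff P i) * x ^ i))"
    by (rule sum.cong) (auto simp flip: power_add)
  also have "\<dots> = of_int c ^ degree P * poly (map_poly of_int P) x"
    by (simp add: poly_altdef sum_distrib_left)
  finally show ?thesis .
qed

lemma poly_dilate_int: "poly (dilate c P) (c * x) = c ^ degree P * poly P x"
  using poly_dilate[of c P x] by simp

text \<open>If c is the leading coefficient of \<open>P\<close>, every coefficient of c^n P(x/c) is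
  divisible by c, and the quotient \<open>R\<close> is monic.\<close>

lemma monic_dilation:
  assumes P: "rat_irreducible P" and d: "degree P > 0"
  obtains R c where "c \<noteq> 0" "irreducible_monic_poly R" "smult c R = dilate c P"
proof -
  define c where "c = lead_coeff P"
  define n where "n = degree P"
  have c0: "c \<noteq> 0" unfolding c_def using d by auto
  define R where "R = (\<Sum>i<n. monom (coeff P i * c ^ (n - 1 - i)) i) + monom 1 n"
  have cR: "coeff R i = (if i < n then coeff P i * c ^ (n - 1 - i) else if i = n then 1 else 0)" for i
    unfolding R_def by (auto simp: coeff_sum)
  have dR: "degree R = n" by (rule antisym) (auto intro!: degree_le le_degree simp: cR)
  have mR: "lead_coeff R = 1" unfolding dR cR by simp
  have eq: "smult c R = dilate c P"
  proof (rule poly_eqI)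
    fix i
    have "c * c ^ (n - 1 - i) = c ^ (n - i)" if "i < n"
      using that by (metis Suc_diff_Suc diff_Suc_eq_diff_pred power_Suc)
    then show "coeff (smult c R) i = coeff (dilate c P) i"
      unfolding dilate_def n_def[symmetric] by (auto simp: cR coeff_sum c_def n_def mult_ac)
  qed
  let ?r = "map_poly (of_int :: int \<Rightarrow> rat)"
  \<comment> \<open>Substituting c x recovers \<open>P\<close> up to a constant, so a factorisation
    of \<open>R\<close> carries over to \<open>P\<close>.\<close>
  have comp: "smult (of_int c) (pcompose (?r R) [:0, of_int c:]) = smult (of_int c ^ n) (?r P)"
  proof (rule poly_ext)
    fix x :: rat
    have "poly (smult (of_int c) (pcompose (?r R) [:0, of_int c:])) x = poly (?r (smult c R)) (of_int c * x)"
      by (simp add: poly_pcompose hom_distribs mult.commute)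
    then show "poly (smult (of_int c) (pcompose (?r R) [:0, of_int c:])) x = poly (smult (of_int c ^ n) (?r P)) x"
      unfolding eq poly_dilate n_def by simp
  qed
  have "irreducible (?r R)"
  proof (rule irreducibleI)
    show "?r R \<noteq> 0" using dR d n_def by auto
    show "\<not> is_unit (?r R)" using dR d n_def by (auto simp: is_unit_iff_degree)
    fix a b assume ab: "?r R = a * b"
    have ab0: "a \<noteq> 0" "b \<noteq> 0" using ab \<open>?r R \<noteq> 0\<close> by auto
    let ?l = "[:0, of_int c:] :: rat poly"
    have "smult (of_int c ^ n) (?r P) = smult (of_int c) (pcompose a ?l * pcompose b ?l)"
      unfolding comp[symmetric] ab by (simp add: pcompose_mult)
    then have "smult (inverse (of_int c ^ n)) (smult (of_int c ^ n) (?r P)) =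
        smult (inverse (of_int c ^ n)) (smult (of_int c) (pcompose a ?l * pcompose b ?l))" by simp
    then have "?r P = smult (inverse (of_int c ^ n) * of_int c) (pcompose a ?l) * pcompose b ?l"
      using c0 by simp
    then have "is_unit (smult (inverse (of_int c ^ n) * of_int c) (pcompose a ?l)) \<or> is_unit (pcompose b ?l)"
      using P by (metis irreducibleD)
    then have "degree (smult (inverse (of_int c ^ n) * of_int c) (pcompose a ?l)) = 0 \<or> degree (pcompose b ?l) = 0"
      by (metis is_unit_polyE degree_pCons_0)
    then have "degree a = 0 \<or> degree b = 0" using c0 by (auto simp: degree_pcompose)
    then show "is_unit a \<or> is_unit b" using ab0 by (auto simp: is_unit_iff_degree)
  qed
  then have "irreducible_monic_poly R"
    using mR dR d n_def by unfold_locales auto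
  then show ?thesis using that c0 eq by blast
qed

lemma root_mod_of_dilate:
  assumes p: "prime p" "\<not> int p dvd N" and y: "int p dvd poly (dilate N P) y"
  obtains x where "[N * x = y] (mod int p)" "int p dvd poly P x"
proof -
  have pi: "prime (int p)" using p(1) by simp
  have "coprime N (int p)" using p(2) pi by (metis coprime_commute prime_imp_coprime)
  then obtain x where "[N * x = 1] (mod int p)" by (metis cong_solve_coprime_int)
  then have x: "[N * (x * y) = y] (mod int p)"
    using cong_mult[OF _ cong_refl, of "N * x" 1 "int p" y] by (simp add: mult.assoc)
  have "int p dvd poly (dilate N P) (N * (x * y))"
    using poly_cong_int[OF x] y by (metis cong_dvd_iff)
  then have "int p dvd N ^ degree P * poly P (x * y)" unfolding poly_dilate_int .
  then have "int p dvd poly P (x * y)" using pi p(2) by (metis prime_dvd_multD prime_dvd_power)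
  then show ?thesis using that x by blast
qed

lemma not_dvd_of_gt: "m \<noteq> 0 \<Longrightarrow> p > nat \<bar>m\<bar> \<Longrightarrow> \<not> int p dvd m"
  using dvd_imp_le_int[of m "int p"] by linarith

text \<open>Write N \<alpha> = U(\<theta>) and N \<beta> = V(\<theta>). At a root z of
  \<open>Q\<close> modulo p, both U(z)/N and V(z)/N are roots of \<open>P\<close>, distinct because
  U - V is coprime to \<open>Q\<close>.\<close>

lemma two_roots_of_primitive_root:
  assumes P: "rat_irreducible P" and d: "degree P \<ge> 2"
  obtains Q B where "rat_irreducible Q" "degree Q > 0"
    "\<And>p. p \<in> root_primes Q \<Longrightarrow> p > B \<Longrightarrow> p \<in> two_root_primes P"
proof -
  obtain Q \<theta> \<alpha> \<beta> where Q: "rat_irreducible Q" "degree Q > 0" "cev Q \<theta> = 0"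
    and ab: "cev P \<alpha> = 0" "cev P \<beta> = 0" "\<alpha> \<noteq> \<beta>" "\<alpha> \<in> rat_span \<theta>" "\<beta> \<in> rat_span \<theta>"
    using primitive_element[OF P d] by blast
  obtain N1 U1 where N1: "N1 > 0" "of_int N1 * \<alpha> = cev U1 \<theta>" using ab(4) unfolding rat_span_def by blast
  obtain N2 U2 where N2: "N2 > 0" "of_int N2 * \<beta> = cev U2 \<theta>" using ab(5) unfolding rat_span_def by blast
  define N where "N = N1 * N2"
  have N0: "N > 0" unfolding N_def using N1 N2 by simp
  define U where "U = smult N2 U1"
  define V where "V = smult N1 U2"
  have U: "cev U \<theta> = of_int N * \<alpha>" unfolding U_def N_def cev_simps N1(2)[symmetric] by simp
  have V: "cev V \<theta> = of_int N * \<beta>" unfolding V_def N_def cev_simps N2(2)[symmetric] by simp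
  have comp: "cev (pcompose (dilate N P) W) \<theta> = cev (dilate N P) (cev W \<theta>)" for W
    by (simp add: of_int_hom.map_poly_pcompose poly_pcompose)
  have "cev (pcompose (dilate N P) U) \<theta> = 0" unfolding comp U poly_dilate ab by simp
  then obtain M1 W1 where W1: "M1 > 0" "smult M1 (pcompose (dilate N P) U) = Q * W1"
    using cev_zero_imp_dvd[OF Q(1,3)] by blast
  have "cev (pcompose (dilate N P) V) \<theta> = 0" unfolding comp V poly_dilate ab by simp
  then obtain M2 W2 where W2: "M2 > 0" "smult M2 (pcompose (dilate N P) V) = Q * W2"
    using cev_zero_imp_dvd[OF Q(1,3)] by blast
  have "cev (U - V) \<theta> \<noteq> 0" unfolding cev_simps U V using ab(3) N0 by simp
  then obtain M3 S T where M3: "M3 > 0" "(U - V) * S + Q * T = [:M3:]"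
    using cev_nonzero_imp_bezout[OF Q(1,3)] by blast
  \<comment> \<open>Excludes the primes dividing one of the auxiliary integers.\<close>
  define B where "B = nat (max (max M1 M2) (max M3 N))"
  show ?thesis
  proof (rule that[OF Q(1,2)])
    fix p assume "p \<in> root_primes Q" and pB: "p > B"
    then obtain z where p: "prime p" and z: "int p dvd poly Q z" unfolding root_primes_def by blast
    have pi: "prime (int p)" using p by simp
    have nd: "\<not> int p dvd M1" "\<not> int p dvd M2" "\<not> int p dvd M3" "\<not> int p dvd N"
    proof -
      have "\<not> int p dvd m" if "m > 0" "m \<le> max (max M1 M2) (max M3 N)" for m
        using that pB unfolding B_def by (intro not_dvd_of_gt) linarith+
      then show "\<not> int p dvd M1" "\<not> int p dvd M2" "\<not> int p dvd M3" "\<not> int p dvd N"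
        using W1(1) W2(1) M3(1) N0 by auto
    qed
    have "M1 * poly (dilate N P) (poly U z) = poly Q z * poly W1 z"
      using arg_cong[OF W1(2), of "\<lambda>f. poly f z"] by (simp add: poly_pcompose)
    then have "int p dvd M1 * poly (dilate N P) (poly U z)" using z by simp
    then have "int p dvd poly (dilate N P) (poly U z)" using pi nd(1) by (metis prime_dvd_multD)
    then obtain x where x: "[N * x = poly U z] (mod int p)" "int p dvd poly P x"
      using root_mod_of_dilate[OF p nd(4)] by blast
    have "M2 * poly (dilate N P) (poly V z) = poly Q z * poly W2 z"
      using arg_cong[OF W2(2), of "\<lambda>f. poly f z"] by (simp add: poly_pcompose)
    then have "int p dvd M2 * poly (dilate N P) (poly V z)" using z by simp
    then have "int p dvd poly (dilate N P) (poly V z)" using pi nd(2) by (metis prime_dvd_multD)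
    then obtain y where y: "[N * y = poly V z] (mod int p)" "int p dvd poly P y"
      using root_mod_of_dilate[OF p nd(4)] by blast
    have "\<not> int p dvd x - y"
    proof
      assume "int p dvd x - y"
      then have "int p dvd N * x - N * y" by (metis dvd_mult right_diff_distrib)
      then have "int p dvd poly U z - poly V z"
        using cong_diff[OF x(1) y(1)] by (metis cong_dvd_iff)
      then have "int p dvd (poly U z - poly V z) * poly S z + poly Q z * poly T z" using z by simp
      also have "\<dots> = M3" using arg_cong[OF M3(2), of "\<lambda>f. poly f z"] by simp
      finally show False using nd(3) by simp
    qed
    then show "p \<in> two_root_primes P" unfolding two_root_primes_def using p x y by blast
  qed
qed

text \<open>Both counting theorems need monic polynomials: \<open>R\<close> and \<open>R'\<close>
  replace \<open>P\<close> and \<open>Q\<close>, which affects only primes dividing the leading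
  coefficients.\<close>

theorem exists_prime_without_root:
  assumes P: "rat_irreducible P" and d: "degree P \<ge> 2"
  shows "\<exists>p>B. prime p \<and> (\<forall>x. \<not> int p dvd poly P x)"
proof (rule ccontr)
  assume "\<not> ?thesis"
  then have roots: "\<exists>x. int p dvd poly P x" if "prime p" "p > B" for p
    using that by blast
  obtain R c where R: "c \<noteq> 0" "irreducible_monic_poly R" "smult c R = dilate c P"
    using monic_dilation[OF P less_le_trans[OF zero_less_numeral d]] by blast
  interpret R: irreducible_monic_poly R by (rule R(2))
  have cR: "c * poly R (c * x) = c ^ degree P * poly P x" for x
    using arg_cong[OF R(3), of "\<lambda>f. poly f (c * x)"] poly_dilate_int[of c P x] by simp
  have RP: "int p dvd poly R (c * x)" if "prime p" "p > nat \<bar>c\<bar>" "int p dvd poly P x" for p x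
  proof -
    have "int p dvd c * poly R (c * x)" unfolding cR using that(3) by simp
    moreover have "\<not> int p dvd c" using not_dvd_of_gt[OF R(1) that(2)] .
    moreover have "prime (int p)" using that(1) by simp
    ultimately show ?thesis by (metis prime_dvd_multD)
  qed
  have "\<not> unbounded_reciprocals (two_root_primes R)"
  proof (rule R.bounded_two_root_primes)
    fix p assume p: "prime p" "p > max B (nat \<bar>c\<bar>)"
    then show "\<exists>x. int p dvd poly R x" using roots[of p] RP[of p] by auto
  qed
  moreover have "unbounded_reciprocals (two_root_primes R)"
  proof -
    obtain Q B1 where Q: "rat_irreducible Q" "degree Q > 0"
      and two: "\<And>p. p \<in> root_primes Q \<Longrightarrow> p > B1 \<Longrightarrow> p \<in> two_root_primes P"
      using two_roots_of_primitive_root[OF P d] by blast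
    obtain R' c' where R': "c' \<noteq> 0" "irreducible_monic_poly R'" "smult c' R' = dilate c' Q"
      using monic_dilation[OF Q] by blast
    have "unbounded_reciprocals (root_primes R')"
      using R'(2) by (rule irreducible_monic_poly.unbounded_root_primes)
    then have "unbounded_reciprocals (root_primes Q)"
    proof (rule unbounded_reciprocals_cofinite)
      fix p assume "p \<in> root_primes R'" and p': "p > nat \<bar>c'\<bar>"
      then obtain y where p: "prime p" and y: "int p dvd poly R' y" unfolding root_primes_def by blast
      have "poly (dilate c' Q) y = c' * poly R' y" unfolding R'(3)[symmetric] by simp
      then have "int p dvd poly (dilate c' Q) y" using y by simp
      then show "p \<in> root_primes Q"
        using root_mod_of_dilate[OF p not_dvd_of_gt[OF R'(1) p']] p unfolding root_primes_def by blast
    qed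
    then have "unbounded_reciprocals (two_root_primes P)"
      by (rule unbounded_reciprocals_cofinite) (rule two)
    then show ?thesis
    proof (rule unbounded_reciprocals_cofinite)
      fix p assume "p \<in> two_root_primes P" and p': "p > nat \<bar>c\<bar>"
      then obtain x y where p: "prime p" and xy: "int p dvd poly P x" "int p dvd poly P y" "\<not> int p dvd x - y"
        unfolding two_root_primes_def by blast
      have "\<not> int p dvd c" using not_dvd_of_gt[OF R(1) p'] .
      moreover have "prime (int p)" using p by simp
      ultimately have "\<not> int p dvd c * x - c * y"
        using xy(3) by (metis prime_dvd_multD right_diff_distrib)
      then show "p \<in> two_root_primes R"
        using RP[OF p p'] xy p unfolding two_root_primes_def by blast
    qed
  qed
  ultimately show False by blast
qed

section \<open>Prime divisors of the sequences\<close>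

text \<open>Ensures that the \<open>LEAST\<close> in \<open>nth_prime\<close> is attained.\<close>

lemma nth_prime_exists:
  assumes "n \<ge> 1"
  shows "\<exists>p :: nat. prime p \<and> card {q. prime q \<and> q \<le> p} = n"
  using assms
proof (induction n rule: nat_induct_at_least)
  case base
  have "{q. prime q \<and> q \<le> (2 :: nat)} = {2}"
    using prime_ge_2_nat by (auto intro: le_antisym)
  then show ?case by (intro exI[of _ 2]) simp
next
  case (Suc n)
  then obtain p :: nat where p: "prime p" "card {q. prime q \<and> q \<le> p} = n" by blast
  define p' where "p' = (LEAST q. prime q \<and> q > p)"
  have ex: "\<exists>q. prime q \<and> q > p" using bigger_prime by blast
  have p': "prime p'" "p' > p" using LeastI_ex[OF ex] unfolding p'_def by auto
  have least: "p' \<le> q" if "prime q" "q > p" for q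
    unfolding p'_def by (rule Least_le) (use that in blast)
  have "{q. prime q \<and> q \<le> p'} = insert p' {q. prime q \<and> q \<le> p}"
    using p' least by (auto simp: le_less_linear) (metis le_antisym linorder_not_le)
  moreover have "finite {q. prime q \<and> q \<le> p}" by (rule finite_subset[of _ "{..p}"]) auto
  ultimately have "card {q. prime q \<and> q \<le> p'} = Suc n" using p p' by simp
  then show ?case using p' by blast
qed

lemma le_nth_prime:
  assumes "n \<ge> 1"
  shows "n \<le> nth_prime n"
proof -
  have "card {q. prime q \<and> q \<le> nth_prime n} = n"
    unfolding nth_prime_def using LeastI_ex[OF nth_prime_exists[OF assms]] by blast
  moreover have "card {q. prime q \<and> q \<le> nth_prime n} \<le> card {1..nth_prime n}"
    by (rule card_mono) (auto dest: prime_ge_1_nat)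
  ultimately show ?thesis by simp
qed

lemma dvd_dfact: "j > 0 \<Longrightarrow> j \<le> n \<Longrightarrow> even (n - j) \<Longrightarrow> j dvd dfact n"
proof (induction n rule: dfact.induct)
  case (3 n)
  show ?case
  proof (cases "j = Suc (Suc n)")
    case False
    then have "j \<le> n" using 3(3,4) by (cases "j = Suc n") auto
    moreover have "even (n - j)" using 3(4) \<open>j \<le> n\<close> by (simp add: Suc_diff_le)
    ultimately show ?thesis using 3 by simp
  next
    case True
    then show ?thesis unfolding dfact.simps by (metis dvd_triv_left)
  qed
qed auto

lemma prime_dvd_primorial: "prime p \<Longrightarrow> p \<le> n \<Longrightarrow> p dvd primorial n"
  unfolding primorial_def
  by (rule dvd_prodI[of "{p. prime p \<and> p \<le> n}" p "\<lambda>p. p", simplified]) (auto intro: finite_subset[of _ "{..n}"])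

text \<open>Both p > 2 and the bound 2 p are due to the double factorial: n!! is odd for odd n, and
  for even n only even factors occur.\<close>

lemma prime_dvd_H:
  assumes p: "prime p" "p > 2" and n: "2 * p \<le> n"
  shows "p dvd H k A n"
proof -
  have p1: "p \<ge> 1" using p(1) by (rule prime_ge_1_nat)
  then have pn: "p \<le> n" "n \<ge> 1" using n by auto
  show ?thesis
  proof (cases k)
    case LcmK
    have "p dvd Lcm {1..n}" by (rule dvd_Lcm) (use p1 pn in auto)
    then show ?thesis using LcmK by (simp add: lcm_upto_def)
  next
    case FactK
    then show ?thesis using p(1) pn by (simp add: prime_dvd_fact_iff)
  next
    case DFactK
    have "p dvd dfact n"
    proof (cases "even (n - p)")
      case True
      then show ?thesis using dvd_dfact p1 pn by simp
    next
      case False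
      \<comment> \<open>Now n is even, so the factor supplying \<open>p\<close> is 2 p.\<close>
      have "odd p" using p by (metis prime_odd_nat)
      then have "even (n - 2 * p)" using False n pn(1) by (simp add: even_diff_nat)
      then have "2 * p dvd dfact n" using dvd_dfact[of "2 * p" n] p1 n by simp
      then show ?thesis by (meson dvd_mult_right)
    qed
    then show ?thesis using DFactK by simp
  next
    case PrimPK
    then show ?thesis using prime_dvd_primorial[OF p(1)] le_nth_prime[OF pn(2)] pn by simp
  next
    case PrimNK
    then show ?thesis using prime_dvd_primorial[OF p(1)] le_nth_prime[OF pn(2)] pn by simp
  next
    case PrimorialK
    then show ?thesis using prime_dvd_primorial[OF p(1)] pn by simp
  qed
qed

theorem theorem1:
  fixes P :: "int poly" and r :: nat and A :: "nat \<Rightarrow> nat" and K :: "nat \<Rightarrow> seq_kind"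
  assumes "irreducible (map_poly (of_int :: int \<Rightarrow> rat) P)"
    and "degree P \<ge> 2"
    and "r \<ge> 1"
    and "\<And>i. i < r \<Longrightarrow> A i > 0"
  shows "finite {(x, ns). length ns = r \<and> (\<forall>i<r. ns ! i \<ge> 1) \<and>
           poly P x = (\<Prod>i<r. int (H (K i) (A i) (ns ! i)))}"
proof -
  obtain p where p: "prime p" "p > 2" "\<And>x. \<not> int p dvd poly P x"
    using exists_prime_without_root[OF assms(1,2)] by blast
  let ?h = "\<lambda>ns. \<Prod>i<r. int (H (K i) (A i) (ns ! i))"
  let ?L = "{ns. set ns \<subseteq> {..<2 * p} \<and> length ns = r}"
  have fin: "finite {x. poly P x = v}" for v
  proof -
    \<comment> \<open>For a fixed right-hand side, x is a root of this nonconstant polynomial; it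
      remains to bound the indices.\<close>
    have "P - [:v:] \<noteq> 0" using assms(2) by (metis degree_pCons_0 eq_iff_diff_eq_0 not_numeral_le_zero)
    then have "finite {x. poly (P - [:v:]) x = 0}" by (rule poly_roots_finite)
    then show ?thesis by simp
  qed
  have "{(x, ns). length ns = r \<and> (\<forall>i<r. ns ! i \<ge> 1) \<and> poly P x = ?h ns}
      \<subseteq> (\<Union>ns\<in>?L. (\<lambda>x. (x, ns)) ` {x. poly P x = ?h ns})"
  proof
    fix y assume "y \<in> {(x, ns). length ns = r \<and> (\<forall>i<r. ns ! i \<ge> 1) \<and> poly P x = ?h ns}"
    then obtain x ns where y: "y = (x, ns)" and ns: "length ns = r" "poly P x = ?h ns" by blast
    have "ns ! i < 2 * p" if i: "i < r" for i
    proof (rule ccontr)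
      assume "\<not> ns ! i < 2 * p"
      then have "int p dvd int (H (K i) (A i) (ns ! i))" using prime_dvd_H[OF p(1,2)] by simp
      also have "\<dots> dvd ?h ns" by (rule dvd_prodI) (use i in auto)
      finally show False using p(3) ns(2) by metis
    qed
    then have "ns \<in> ?L" using ns(1) by (auto simp: set_conv_nth)
    then show "y \<in> (\<Union>ns\<in>?L. (\<lambda>x. (x, ns)) ` {x. poly P x = ?h ns})"
      unfolding y using ns(2) by blast
  qed
  moreover have "finite (\<Union>ns\<in>?L. (\<lambda>x. (x, ns)) ` {x. poly P x = ?h ns})"
    using fin by (auto intro!: finite_lists_length_eq)
  ultimately show ?thesis by (rule finite_subset)
qed

end
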